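(* For all real $x\ge 1$ and $y\ge 2$, with $u=\frac{\log x}{\log y}$, the following four identities hold: $$\Delta(x,y) =R(x,y) + x \int_{-\infty}^u \frac{R(y^v,y)}{ y^{v}}\, \rho'(u-v)\, dv,$$ $$\Delta(x,y) =R^*(x,y) + x \int_{0}^u \frac{R^*(y^v,y)}{ y^{v}}\, \rho'(u-v)\, dv,$$ $$R(x,y) = \Delta(x,y)+x \int_0^\infty \frac{\Delta(y^v,y)}{y^v} \left(\omega(u-v)-e^{-\gamma}\right) dv,$$ $$R^*(x,y) = \Delta(x,y)+x \int_0^u \frac{\Delta(y^v,y)}{y^v}\,\omega(u-v)\, dv.$$
   Context: Notation. $\gamma$ is Euler's constant; $\{x\}$ is the fractional part of $x$; $p$ denotes primes; $1_{x\ge1}$ equals $1$ if $x\ge 1$ and $0$ otherwise. Throughout $u=\log x/\log y$. $\rho$ is Dickman's function: $\rho(u)=0$ for $u<0$, $\rho(u)=1$ for $0\le u\le 1$, $\rho$ is continuous on $[0,\infty)$ and $u\rho'(u)=-\rho(u-1)$ for $u>1$; $\rho'(u)$ is defined by right-continuity at $u=0,1$ (so $\rho'(0)=0$, $\rho'(1)=-1$). $\omega$ is Buchstab's function: $\omega(u)=0$ for $u<1$, $\omega(u)=1/u$ for $1\le u\le 2$, $\omega$ is continuous on $[1,\infty)$ and $(u\omega(u))'=\omega(u-1)$ for $u>2$. $\mathcal S_y$ is the set of positive integers all of whose prime factors are $\le y$ (so $1\in\mathcal S_y$). $\Psi(x,y)=|\mathcal S_y\cap[1,x]|$. $\Phi(x,y)$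 is the number of integers $1\le n\le x$ all of whose prime factors are $>y$ (including $n=1$). $\Pi(y)=\prod_{p\le y}(1-1/p)$. $\mu_y(u)=\int_0^u \omega(u-v)y^{-v}\,dv$ (so $\mu_y(u)=0$ for $u<1$, including $u<0$). For $x\ge1$, $y\ge2$: $$\Lambda(x,y)= x \rho(u)-\{x\}-x\int_0^u \rho'(u-v) \frac{\{y^v\}}{y^v}\, dv,\qquad \Delta(x,y)=\Psi(x,y)-\Lambda(x,y).$$ For $x>0$, $y\ge 2$: $$V(x,y)=1_{x\ge 1} + x \Big( \Pi(y) - \frac{e^{-\gamma}}{\log y} +\mu_y(u)\Big),\qquad V^*(x,y)=1_{x\ge 1} + x \mu_y(u),$$ $$Q(x,y)=V(x,y)-\Phi(x,y),\qquad Q^*(x,y)=V^*(x,y)-\Phi(x,y),$$ $$R(x,y)=\sum_{n\in\mathcal S_y}Q(x/n,y),\qquad R^*(x,y)=\sum_{n\in\mathcal S_y}Q^*(x/n,y),$$ where the sums are over all of the set $\mathcal S_y$ (they converge absolutely). *)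

theory Defs
  imports
    "HOL-Analysis.Analysis"
    "HOL-Computational_Algebra.Primes"
begin

text \<open>
  Existence and uniqueness for \<open>u * f' u = k * f (u - 1)\<close> (\<open>u > 1\<close>) with \<open>f = 1\<close> on \<open>[0, 1]\<close>.
  Dickman's function is the case \<open>k = - 1\<close>; for \<open>k = 1\<close> the solution is
  \<open>s \<mapsto> (s + 1) * \<omega> (s + 1)\<close> with \<open>\<omega>\<close> Buchstab's function.
\<close>

lemma delay_equation_exists:
  fixes k :: real
  obtains f :: "real \<Rightarrow> real" where
    "continuous_on UNIV f"
    "\<And>u. u \<le> 1 \<Longrightarrow> f u = 1"
    "\<And>u. u > 1 \<Longrightarrow> (f has_real_derivative k * f (u - 1) / u) (at u)"
proof -
  define F :: "nat \<Rightarrow> real \<Rightarrow> real" where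
    "F = rec_nat (\<lambda>_. 1) (\<lambda>_ g u. 1 + integral {1..u} (\<lambda>t. k * g (t - 1) / t))"
  have F0: "F 0 = (\<lambda>_. 1)" by (simp add: F_def)
  have FS: "F (Suc n) u = 1 + integral {1..u} (\<lambda>t. k * F n (t - 1) / t)" for n u
    by (simp add: F_def)
  have F1: "F n u = 1" if "u \<le> 1" for n u
  proof (cases n)
    case (Suc m)
    show ?thesis
    proof (cases "u = 1")
      case False
      then have "{1..u} = {}" using that by auto
      then show ?thesis by (simp add: Suc FS)
    qed (simp add: Suc FS)
  qed (simp add: F0)
  have cont_der: "continuous_on UNIV (F n) \<and>
      (\<forall>u>1. (F (Suc n) has_real_derivative k * F n (u - 1) / u) (at u))" for n
  proof (induction n)
    have *: "continuous_on UNIV (F (Suc n)) \<and>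
      (\<forall>u>1. (F (Suc n) has_real_derivative k * F n (u - 1) / u) (at u))"
      if c: "continuous_on UNIV (F n)" for n
    proof -
      have ci: "continuous_on {1..b} (\<lambda>t. k * F n (t - 1) / t)" for b
        by (intro continuous_intros continuous_on_compose2[OF c]) auto
      have cS: "continuous_on {1..b} (F (Suc n))" for b
        unfolding FS
        by (intro continuous_intros indefinite_integral_continuous_1 integrable_continuous_real ci)
      have d: "(F (Suc n) has_real_derivative k * F n (u - 1) / u) (at u)" if u: "u > 1" for u
      proof -
        have "((\<lambda>x. integral {1..x} (\<lambda>t. k * F n (t - 1) / t)) has_real_derivative
                k * F n (u - 1) / u) (at u within {1..u + 1})"
          by (rule integral_has_real_derivative[OF ci]) (use u in auto)
        moreover have "at u within {1..u + 1} = at u"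
          by (rule at_within_interior) (use u in auto)
        ultimately show ?thesis
          unfolding FS by (auto intro!: derivative_eq_intros)
      qed
      have "continuous_on ({..1} \<union> {1..}) (F (Suc n))"
      proof (rule continuous_on_closed_Un)
        show "continuous_on {..1} (F (Suc n))"
          by (rule continuous_on_eq[of _ "\<lambda>_. 1"]) (auto simp: F1)
        show "continuous_on {1..} (F (Suc n))"
          unfolding continuous_on_eq_continuous_within
        proof
          fix x :: real assume x: "x \<in> {1..}"
          have "continuous (at x within {1..x + 1}) (F (Suc n))"
            using cS[of "x + 1"] x by (simp add: continuous_on_eq_continuous_within)
          moreover have "at x within {1..x + 1} = at x within {1..}"
            by (rule at_within_nhd[of _ "{..<x + 1}"]) auto
          ultimately show "continuous (at x within {1..}) (F (Suc n))"
            by (simp add: continuous_within)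
        qed
      qed auto
      moreover have "{..1} \<union> {1..} = (UNIV :: real set)" by auto
      ultimately show ?thesis using d by simp
    qed
    show "continuous_on UNIV (F 0) \<and>
      (\<forall>u>1. (F (Suc 0) has_real_derivative k * F 0 (u - 1) / u) (at u))"
      using *[of 0] by (simp add: F0)
    show "continuous_on UNIV (F (Suc n)) \<and>
      (\<forall>u>1. (F (Suc (Suc n)) has_real_derivative k * F (Suc n) (u - 1) / u) (at u))"
      if "continuous_on UNIV (F n) \<and>
      (\<forall>u>1. (F (Suc n) has_real_derivative k * F n (u - 1) / u) (at u))" for n
      using *[of n] *[of "Suc n"] that by blast
  qed
  have step: "\<forall>u \<le> real n + 1. F (Suc n) u = F n u" for n
  proof (induction n)
    case 0
    then show ?case using F1 by simp
  next
    case (Suc n)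
    show ?case
    proof (intro allI impI)
      fix u :: real assume u: "u \<le> real (Suc n) + 1"
      have "integral {1..u} (\<lambda>t. k * F (Suc n) (t - 1) / t) =
            integral {1..u} (\<lambda>t. k * F n (t - 1) / t)"
        by (rule integral_cong) (use Suc u in auto)
      then show "F (Suc (Suc n)) u = F (Suc n) u" by (simp only: FS)
    qed
  qed
  have stable: "F m u = F n u" if "n \<le> m" "u \<le> real n + 1" for m n u
    using that by (induction rule: dec_induct) (use step in auto)
  define f where "f u = F (nat \<lceil>u\<rceil>) u" for u
  have f_eq: "f u = F n u" if "u \<le> real n + 1" for u n
  proof (cases "n \<le> nat \<lceil>u\<rceil>")
    case True
    then show ?thesis using stable[OF True that] by (simp add: f_def)
  next
    case False
    then show ?thesis unfolding f_def by (intro stable[symmetric]) linarith+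
  qed
  have near: "\<forall>\<^sub>F x in nhds u. f x = F n x" if "u < real n + 1" for u n
  proof -
    have "\<forall>\<^sub>F x in nhds u. x \<in> {..<real n + 1}"
      by (rule eventually_nhds_in_open) (use that in auto)
    then show ?thesis by eventually_elim (auto intro!: f_eq)
  qed
  show ?thesis
  proof (rule that)
    show "f u = 1" if "u \<le> 1" for u using f_eq[of u 0] F0 that by simp
    show "(f has_real_derivative k * f (u - 1) / u) (at u)" if "u > 1" for u
    proof -
      define n where "n = nat \<lceil>u\<rceil>"
      have n: "u < real (Suc n) + 1" "u - 1 \<le> real n + 1" unfolding n_def by linarith+
      have "(F (Suc n) has_real_derivative k * F n (u - 1) / u) (at u)"
        using cont_der[of n] that by blast
      then show ?thesis
        using DERIV_cong_ev[OF refl near[OF n(1)] refl] f_eq[OF n(2)] by simp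
    qed
    show "continuous_on UNIV f"
      unfolding continuous_on_eq_continuous_at[OF open_UNIV]
    proof
      fix u :: real
      obtain n :: nat where n: "u < real n" using reals_Archimedean2 by blast
      have "isCont (F n) u"
        using cont_der[of n] by (simp add: continuous_on_eq_continuous_at)
      then show "isCont f u" using isCont_cong[OF near[of u n]] n by simp
    qed
  qed
qed

lemma delay_equation_unique:
  fixes f g :: "real \<Rightarrow> real"
  assumes cont: "continuous_on {0..} f" "continuous_on {0..} g"
    and init: "\<And>u. 0 \<le> u \<Longrightarrow> u \<le> 1 \<Longrightarrow> f u = g u"
    and der: "\<And>u. u > 1 \<Longrightarrow> (f has_real_derivative k * f (u - 1) / u) (at u)"
      "\<And>u. u > 1 \<Longrightarrow> (g has_real_derivative k * g (u - 1) / u) (at u)"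
    and "0 \<le> u"
  shows "f u = g u"
proof -
  have "\<forall>u. 0 \<le> u \<and> u \<le> real n + 1 \<longrightarrow> f u = g u" for n
  proof (induction n)
    case 0
    then show ?case using init by simp
  next
    case (Suc n)
    show ?case
    proof (intro allI impI)
      fix u :: real assume u: "0 \<le> u \<and> u \<le> real (Suc n) + 1"
      show "f u = g u"
      proof (cases "u \<le> real n + 1")
        case True
        then show ?thesis using Suc u by blast
      next
        case False
        have "f u - g u = f (real n + 1) - g (real n + 1)"
        proof (rule DERIV_isconst2[where a = "real n + 1" and b = u])
          show "continuous_on {real n + 1..u} (\<lambda>x. f x - g x)"
            by (intro continuous_intros continuous_on_subset[OF cont(1)]
                continuous_on_subset[OF cont(2)]) auto
          fix x assume x: "real n + 1 < x" "x < u"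
          have "f (x - 1) = g (x - 1)" using Suc x u by auto
          then show "((\<lambda>x. f x - g x) has_real_derivative 0) (at x)"
            using DERIV_diff[OF der(1)[of x] der(2)[of x]] x by simp
        qed (use False in auto)
        then show ?thesis using Suc by simp
      qed
    qed
  qed
  moreover have "u \<le> real (nat \<lceil>u\<rceil>) + 1" by linarith
  ultimately show ?thesis using \<open>0 \<le> u\<close> by blast
qed

definition is_dickman :: "(real \<Rightarrow> real) \<Rightarrow> bool" where
  "is_dickman \<rho> \<longleftrightarrow>
     (\<forall>u<0. \<rho> u = 0) \<and> (\<forall>u\<in>{0..1}. \<rho> u = 1) \<and> continuous_on {0..} \<rho> \<and>
     (\<forall>u>1. \<rho> differentiable (at u) \<and> u * deriv \<rho> u = - \<rho> (u - 1))"

definition dickman :: "real \<Rightarrow> real" where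
  "dickman = (THE \<rho>. is_dickman \<rho>)"

lemma is_dickman_derivI:
  assumes "is_dickman \<rho>" "u > 1"
  shows "(\<rho> has_real_derivative - \<rho> (u - 1) / u) (at u)"
proof -
  have "(\<rho> has_real_derivative deriv \<rho> u) (at u)"
    using assms by (auto simp: is_dickman_def DERIV_deriv_iff_real_differentiable)
  moreover have "u * deriv \<rho> u = - \<rho> (u - 1)" using assms by (simp add: is_dickman_def)
  then have "deriv \<rho> u = - \<rho> (u - 1) / u" using assms(2) by (simp add: field_simps)
  ultimately show ?thesis by simp
qed

lemma ex1_dickman: "\<exists>!\<rho>. is_dickman \<rho>"
proof (rule ex_ex1I)
  obtain f :: "real \<Rightarrow> real" where f: "continuous_on UNIV f" "\<And>u. u \<le> 1 \<Longrightarrow> f u = 1"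
    "\<And>u. u > 1 \<Longrightarrow> (f has_real_derivative (- 1) * f (u - 1) / u) (at u)"
    using delay_equation_exists[of "- 1"] by blast
  define \<rho> where "\<rho> u = (if u < 0 then 0 else f u)" for u
  have der: "(\<rho> has_real_derivative - \<rho> (u - 1) / u) (at u)" if "u > 1" for u
  proof -
    have "\<forall>\<^sub>F x in nhds u. x \<in> {0<..}" by (rule eventually_nhds_in_open) (use that in auto)
    then have "\<forall>\<^sub>F x in nhds u. \<rho> x = f x" by eventually_elim (auto simp: \<rho>_def)
    moreover have "\<rho> (u - 1) = f (u - 1)" using that by (simp add: \<rho>_def)
    ultimately show ?thesis using f(3)[OF that] DERIV_cong_ev[of u u \<rho> f] by simp
  qed
  have "is_dickman \<rho>"
    unfolding is_dickman_def
  proof (intro conjI allI impI ballI)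
    show "continuous_on {0..} \<rho>"
      using continuous_on_subset[OF f(1), of "{0..}"]
      by (rule continuous_on_eq) (auto simp: \<rho>_def)
    show "\<rho> differentiable at u" if "u > 1" for u
      using der[OF that] real_differentiable_def by blast
    show "u * deriv \<rho> u = - \<rho> (u - 1)" if "u > 1" for u
      using DERIV_imp_deriv[OF der[OF that]] that by simp
  qed (auto simp: \<rho>_def f(2))
  then show "\<exists>\<rho>. is_dickman \<rho>" by blast
next
  fix f g assume fg: "is_dickman f" "is_dickman g"
  show "f = g"
  proof
    fix u :: real
    show "f u = g u"
    proof (cases "u < 0")
      case False
      show ?thesis
      proof (rule delay_equation_unique[where k = "- 1" and f = f and g = g and u = u])
        show "continuous_on {0..} f" "continuous_on {0..} g"
          using fg by (simp_all add: is_dickman_def)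
        show "f v = g v" if "0 \<le> v" "v \<le> 1" for v
          using fg that by (simp add: is_dickman_def)
        show "(f has_real_derivative - 1 * f (v - 1) / v) (at v)" if "v > 1" for v
          using is_dickman_derivI[OF fg(1) that] by simp
        show "(g has_real_derivative - 1 * g (v - 1) / v) (at v)" if "v > 1" for v
          using is_dickman_derivI[OF fg(2) that] by simp
      qed (use False in simp)
    qed (use fg in \<open>auto simp: is_dickman_def\<close>)
  qed
qed

lemma is_dickman_dickman: "is_dickman dickman"
  unfolding dickman_def by (rule theI'[OF ex1_dickman])

definition is_buchstab :: "(real \<Rightarrow> real) \<Rightarrow> bool" where
  "is_buchstab \<omega> \<longleftrightarrow>
     (\<forall>u<1. \<omega> u = 0) \<and> (\<forall>u\<in>{1..2}. \<omega> u = 1 / u) \<and> continuous_on {1..} \<omega> \<and>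
     (\<forall>u>2. ((\<lambda>t. t * \<omega> t) has_real_derivative \<omega> (u - 1)) (at u))"

definition buchstab :: "real \<Rightarrow> real" where
  "buchstab = (THE \<omega>. is_buchstab \<omega>)"

lemma ex1_buchstab: "\<exists>!\<omega>. is_buchstab \<omega>"
proof (rule ex_ex1I)
  obtain f :: "real \<Rightarrow> real" where f: "continuous_on UNIV f" "\<And>u. u \<le> 1 \<Longrightarrow> f u = 1"
    "\<And>u. u > 1 \<Longrightarrow> (f has_real_derivative 1 * f (u - 1) / u) (at u)"
    using delay_equation_exists[of 1] by blast
  define \<omega> where "\<omega> u = (if u < 1 then 0 else f (u - 1) / u)" for u
  have "is_buchstab \<omega>"
    unfolding is_buchstab_def
  proof (intro conjI allI impI ballI)
    have "continuous_on {1..} (\<lambda>u. f (u - 1) / u)"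
      by (intro continuous_intros continuous_on_compose2[OF f(1)]) auto
    then show "continuous_on {1..} \<omega>"
      by (rule continuous_on_eq) (auto simp: \<omega>_def)
    fix u :: real assume u: "u > 2"
    have "\<forall>\<^sub>F x in nhds u. x \<in> {1<..}" by (rule eventually_nhds_in_open) (use u in auto)
    then have ev: "\<forall>\<^sub>F x in nhds u. x * \<omega> x = f (x - 1)"
      by eventually_elim (auto simp: \<omega>_def)
    have "(f has_real_derivative 1 * f (u - 1 - 1) / (u - 1)) (at (u - 1))"
      using u by (intro f(3)) auto
    then have "((\<lambda>x. f (x - 1)) has_real_derivative f (u - 1 - 1) / (u - 1)) (at u)"
      using DERIV_shift[of f _ u "- 1"] by simp
    then show "((\<lambda>t. t * \<omega> t) has_real_derivative \<omega> (u - 1)) (at u)"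
      using DERIV_cong_ev[OF refl ev refl] u by (simp add: \<omega>_def)
  qed (auto simp: \<omega>_def f(2))
  then show "\<exists>\<omega>. is_buchstab \<omega>" by blast
next
  have *: "continuous_on {0..} (\<lambda>s. (s + 1) * \<omega> (s + 1))"
    "\<And>s. 0 \<le> s \<Longrightarrow> s \<le> 1 \<Longrightarrow> (s + 1) * \<omega> (s + 1) = 1"
    "\<And>s. s > 1 \<Longrightarrow> ((\<lambda>s. (s + 1) * \<omega> (s + 1)) has_real_derivative
        1 * ((s - 1 + 1) * \<omega> (s - 1 + 1)) / s) (at s)"
    if w: "is_buchstab \<omega>" for \<omega>
  proof -
    show "continuous_on {0..} (\<lambda>s. (s + 1) * \<omega> (s + 1))"
    proof (rule continuous_on_mult)
      have "continuous_on {1..} \<omega>" using w by (simp add: is_buchstab_def)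
      moreover have "continuous_on {0..} (\<lambda>s::real. s + 1)" by (intro continuous_intros)
      moreover have "(\<lambda>s::real. s + 1) ` {0..} \<subseteq> {1..}" by auto
      ultimately show "continuous_on {0..} (\<lambda>s. \<omega> (s + 1))"
        by (rule continuous_on_compose2)
    qed (intro continuous_intros)
    show "(s + 1) * \<omega> (s + 1) = 1" if "0 \<le> s" "s \<le> 1" for s
      using w that by (simp add: is_buchstab_def)
    show "((\<lambda>s. (s + 1) * \<omega> (s + 1)) has_real_derivative
        1 * ((s - 1 + 1) * \<omega> (s - 1 + 1)) / s) (at s)" if s: "s > 1" for s
    proof -
      have "((\<lambda>t. t * \<omega> t) has_real_derivative \<omega> (s + 1 - 1)) (at (s + 1))"
      proof -
        have "\<forall>u>2. ((\<lambda>t. t * \<omega> t) has_real_derivative \<omega> (u - 1)) (at u)"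
          using w unfolding is_buchstab_def by (elim conjE)
        moreover have "s + 1 > 2" using s by simp
        ultimately show ?thesis by blast
      qed
      then show ?thesis
        using DERIV_shift[of "\<lambda>t. t * \<omega> t" _ s 1] s by simp
    qed
  qed
  fix f g assume fg: "is_buchstab f" "is_buchstab g"
  show "f = g"
  proof
    fix u :: real
    show "f u = g u"
    proof (cases "u < 1")
      case False
      have "(u - 1 + 1) * f (u - 1 + 1) = (u - 1 + 1) * g (u - 1 + 1)"
      proof (rule delay_equation_unique[where k = 1 and u = "u - 1"
              and f = "\<lambda>s. (s + 1) * f (s + 1)" and g = "\<lambda>s. (s + 1) * g (s + 1)"])
        show "(v + 1) * f (v + 1) = (v + 1) * g (v + 1)" if "0 \<le> v" "v \<le> 1" for v
          using *(2)[OF fg(1) that] *(2)[OF fg(2) that] by simp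
        show "0 \<le> u - 1" using False by simp
      qed (fact *(1)[OF fg(1)], fact *(1)[OF fg(2)],
          fact *(3)[OF fg(1)], fact *(3)[OF fg(2)])
      then show ?thesis using False by simp
    qed (use fg in \<open>auto simp: is_buchstab_def\<close>)
  qed
qed

lemma is_buchstab_buchstab: "is_buchstab buchstab"
  unfolding buchstab_def by (rule theI'[OF ex1_buchstab])

text \<open>
  At \<open>0\<close> and \<open>1\<close>, where Dickman's function is not differentiable, the derivative is
  extended by right-continuity.
\<close>

definition dickman_deriv :: "real \<Rightarrow> real" where
  "dickman_deriv u =
     (if u = 0 \<or> u = 1 then Lim (at_right u) (deriv dickman) else deriv dickman u)"

lemma dickman_deriv_0 [simp]: "dickman_deriv 0 = 0"
proof -
  have "\<forall>\<^sub>F u in at_right 0. deriv dickman u = 0"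
  proof (rule eventually_at_rightI[of 0 1])
    fix u :: real assume u: "u \<in> {0<..<1}"
    have "\<forall>\<^sub>F x in nhds u. x \<in> {0<..<1}" by (rule eventually_nhds_in_open) (use u in auto)
    then have "\<forall>\<^sub>F x in nhds u. dickman x = 1"
      by eventually_elim (use is_dickman_dickman in \<open>auto simp: is_dickman_def\<close>)
    then have "deriv dickman u = deriv (\<lambda>_. 1) u" by (intro deriv_cong_ev) auto
    then show "deriv dickman u = 0" by simp
  qed simp
  then have "(deriv dickman \<longlongrightarrow> 0) (at_right 0)" by (rule tendsto_eventually)
  then show ?thesis by (simp add: dickman_deriv_def tendsto_Lim)
qed

lemma dickman_deriv_1 [simp]: "dickman_deriv 1 = - 1"
proof -
  have "\<forall>\<^sub>F u in at_right 1. deriv dickman u = - 1 / u"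
  proof (rule eventually_at_rightI[of 1 2])
    fix u :: real assume u: "u \<in> {1<..<2}"
    then have "dickman (u - 1) = 1"
      using is_dickman_dickman by (auto simp: is_dickman_def)
    then show "deriv dickman u = - 1 / u"
      using DERIV_imp_deriv[OF is_dickman_derivI[OF is_dickman_dickman, of u]] u by simp
  qed simp
  moreover have "((\<lambda>u::real. - 1 / u) \<longlongrightarrow> - 1 / 1) (at_right 1)"
    by (intro tendsto_intros) auto
  ultimately have "(deriv dickman \<longlongrightarrow> - 1) (at_right 1)"
    by (simp add: tendsto_cong)
  then show ?thesis by (simp add: dickman_deriv_def tendsto_Lim)
qed

definition smooth :: "real \<Rightarrow> nat set" where
  "smooth y = {n. n > 0 \<and> (\<forall>p. prime p \<and> p dvd n \<longrightarrow> real p \<le> y)}"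

definition Psi :: "real \<Rightarrow> real \<Rightarrow> nat" where
  "Psi x y = card {n \<in> smooth y. real n \<le> x}"

definition Phi :: "real \<Rightarrow> real \<Rightarrow> nat" where
  "Phi x y = card {n::nat. 1 \<le> n \<and> real n \<le> x \<and> (\<forall>p. prime p \<and> p dvd n \<longrightarrow> real p > y)}"

definition Pi_prod :: "real \<Rightarrow> real" where
  "Pi_prod y = (\<Prod>p | prime p \<and> real p \<le> y. 1 - 1 / real p)"

text \<open>
  For \<open>u < 0\<close> the interval \<open>{0..u}\<close> is empty, so \<open>mu y u = 0\<close>.
\<close>

definition mu :: "real \<Rightarrow> real \<Rightarrow> real" where
  "mu y u = (LBINT v:{0..u}. buchstab (u - v) * y powr (- v))"

definition Lambda :: "real \<Rightarrow> real \<Rightarrow> real" where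
  "Lambda x y = (let u = ln x / ln y in
     x * dickman u - frac x -
     x * (LBINT v:{0..u}. dickman_deriv (u - v) * (frac (y powr v) / y powr v)))"

definition Delta :: "real \<Rightarrow> real \<Rightarrow> real" where
  "Delta x y = real (Psi x y) - Lambda x y"

definition V :: "real \<Rightarrow> real \<Rightarrow> real" where
  "V x y = (let u = ln x / ln y in
     of_bool (x \<ge> 1) + x * (Pi_prod y - exp (- euler_mascheroni) / ln y + mu y u))"

definition V_star :: "real \<Rightarrow> real \<Rightarrow> real" where
  "V_star x y = (let u = ln x / ln y in of_bool (x \<ge> 1) + x * mu y u)"

definition Q :: "real \<Rightarrow> real \<Rightarrow> real" where
  "Q x y = V x y - real (Phi x y)"

definition Q_star :: "real \<Rightarrow> real \<Rightarrow> real" where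
  "Q_star x y = V_star x y - real (Phi x y)"

text \<open>
  For \<open>x > 0\<close> and \<open>y \<ge> 2\<close> the following two series converge absolutely; see
  \<open>summable_on_R\<close> and \<open>summable_on_R_star\<close> below (over the reals, being summable on a set
  and being absolutely summable on it coincide).
\<close>

definition R :: "real \<Rightarrow> real \<Rightarrow> real" where
  "R x y = (\<Sum>\<^sub>\<infinity>n\<in>smooth y. Q (x / real n) y)"

definition R_star :: "real \<Rightarrow> real \<Rightarrow> real" where
  "R_star x y = (\<Sum>\<^sub>\<infinity>n\<in>smooth y. Q_star (x / real n) y)"

lemma summable_on_inverse_prime_factors:
  assumes "finite P" "\<And>p. p \<in> P \<Longrightarrow> prime p"
  shows "(\<lambda>n::nat. 1 / real n) summable_on {n. n > 0 \<and> (\<forall>p. prime p \<and> p dvd n \<longrightarrow> p \<in> P)}"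
  using assms
proof (induction P rule: finite_induct)
  case empty
  have "{n::nat. n > 0 \<and> (\<forall>p. prime p \<and> p dvd n \<longrightarrow> p \<in> {})} \<subseteq> {1}"
    using prime_factor_nat by auto
  then show ?case by (meson finite.emptyI finite_insert finite_subset summable_on_finite)
next
  case (insert p P)
  define S where "S = {n::nat. n > 0 \<and> (\<forall>q. prime q \<and> q dvd n \<longrightarrow> q \<in> P)}"
  have p: "prime p" "p \<notin> P" using insert by auto
  have p1: "p > 1" using prime_gt_1_nat[OF p(1)] .
  have nd: "\<not> p dvd m" if "m \<in> S" for m using that p by (auto simp: S_def)
  have sS: "(\<lambda>n. 1 / real n) summable_on S"
    using insert unfolding S_def by blast
  have geo: "(\<lambda>k. (1 / real p) ^ k) summable_on UNIV"
    by (rule norm_summable_imp_summable_on) (use p1 in \<open>auto intro!: summable_geometric\<close>)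
  have "(\<lambda>(k, m). (1 / real p) ^ k * (1 / real m)) summable_on (UNIV \<times> S)"
  proof (rule summable_on_SigmaI)
    fix k
    show "((\<lambda>m. case (k, m) of (k, m) \<Rightarrow> (1 / real p) ^ k * (1 / real m)) has_sum
        (1 / real p) ^ k * (\<Sum>\<^sub>\<infinity>m\<in>S. 1 / real m)) S"
      using has_sum_cmult_right[OF has_sum_infsum[OF sS]] by simp
  next
    show "(\<lambda>k. (1 / real p) ^ k * (\<Sum>\<^sub>\<infinity>m\<in>S. 1 / real m)) summable_on UNIV"
      using summable_on_cmult_left[OF geo] .
  qed auto
  moreover have "(\<lambda>n. 1 / real n) summable_on
        {n. n > 0 \<and> (\<forall>q. prime q \<and> q dvd n \<longrightarrow> q \<in> insert p P)} \<longleftrightarrow>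
      (\<lambda>(k, m). (1 / real p) ^ k * (1 / real m)) summable_on (UNIV \<times> S)"
  proof (rule summable_on_reindex_bij_witness
      [where j = "\<lambda>n. (multiplicity p n, n div p ^ multiplicity p n)" and i = "\<lambda>(k, m). p ^ k * m"])
    fix n assume "n \<in> {n. n > 0 \<and> (\<forall>q. prime q \<and> q dvd n \<longrightarrow> q \<in> insert p P)}"
    then have n: "n > 0" "\<And>q. prime q \<Longrightarrow> q dvd n \<Longrightarrow> q = p \<or> q \<in> P" by auto
    have dv: "p ^ multiplicity p n dvd n" by (rule multiplicity_dvd)
    show "(case (multiplicity p n, n div p ^ multiplicity p n) of (k, m) \<Rightarrow> p ^ k * m) = n"
      using dv by simp
    have "n div p ^ multiplicity p n dvd n" using dv by (metis dvd_mult_div_cancel dvd_triv_right)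
    moreover have "\<not> p dvd n div p ^ multiplicity p n"
      by (rule multiplicity_decompose) (use n p1 in auto)
    moreover have "n div p ^ multiplicity p n > 0"
      using dv n(1) by (metis dvd_mult_div_cancel gr0I less_irrefl mult_0_right)
    ultimately have "n div p ^ multiplicity p n \<in> S"
      using n(2) unfolding S_def by (auto dest: dvd_trans)
    then show "(multiplicity p n, n div p ^ multiplicity p n) \<in> UNIV \<times> S" by simp
    have "real n = real p ^ multiplicity p n * real (n div p ^ multiplicity p n)"
      using dv by (metis dvd_mult_div_cancel of_nat_mult of_nat_power)
    then show "(case (multiplicity p n, n div p ^ multiplicity p n) of
        (k, m) \<Rightarrow> (1 / real p) ^ k * (1 / real m)) = 1 / real n"
      by (simp add: power_divide)
  next
    fix b assume "b \<in> (UNIV :: nat set) \<times> S"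
    then obtain k m where b: "b = (k, m)" "m \<in> S" by auto
    have m: "multiplicity p (p ^ k * m) = k"
      by (rule multiplicity_decomposeI[OF refl nd[OF b(2)]]) (use p1 in auto)
    show "(multiplicity p (case b of (k, m) \<Rightarrow> p ^ k * m),
        (case b of (k, m) \<Rightarrow> p ^ k * m) div p ^ multiplicity p (case b of (k, m) \<Rightarrow> p ^ k * m)) = b"
      using p1 by (simp add: b(1) m)
    have "q = p \<or> q \<in> P" if "prime q" "q dvd p ^ k * m" for q
    proof -
      have "q dvd p \<or> q dvd m"
        using that by (metis prime_dvd_mult_iff prime_dvd_power)
      then show ?thesis
        using that(1) b(2) p(1) primes_dvd_imp_eq[of q p] by (auto simp: S_def)
    qed
    then show "(case b of (k, m) \<Rightarrow> p ^ k * m) \<in>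
        {n. n > 0 \<and> (\<forall>q. prime q \<and> q dvd n \<longrightarrow> q \<in> insert p P)}"
      using b p1 by (auto simp: S_def)
  qed
  ultimately show ?case by blast
qed

lemma summable_on_inverse_smooth: "(\<lambda>n. 1 / real n) summable_on smooth y"
proof -
  have "finite {p::nat. prime p \<and> real p \<le> y}"
    by (rule finite_subset[of _ "{..nat \<lceil>y\<rceil>}"]) (auto, linarith)
  then have "(\<lambda>n. 1 / real n) summable_on
      {n. n > 0 \<and> (\<forall>p. prime p \<and> p dvd n \<longrightarrow> p \<in> {p. prime p \<and> real p \<le> y})}"
    by (rule summable_on_inverse_prime_factors) simp
  moreover have "{n. n > 0 \<and> (\<forall>p. prime p \<and> p dvd n \<longrightarrow> p \<in> {p. prime p \<and> real p \<le> y})} = smooth y"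
    by (auto simp: smooth_def)
  ultimately show ?thesis by simp
qed

lemma summable_on_smooth_aux:
  assumes "\<And>z. 0 < z \<Longrightarrow> z < 1 \<Longrightarrow> f z = c * z" "x > 0"
  shows "(\<lambda>n. f (x / real n) :: real) summable_on smooth y"
proof -
  define A where "A = smooth y \<inter> {n. real n \<le> x}"
  have "finite A"
    unfolding A_def by (rule finite_subset[of _ "{..nat \<lceil>x\<rceil>}"]) (auto, linarith)
  have "(\<lambda>n. c * x * (1 / real n)) summable_on (smooth y - A)"
    by (intro summable_on_cmult_right summable_on_subset_banach[OF summable_on_inverse_smooth]) auto
  moreover have "f (x / real n) = c * x * (1 / real n)" if "n \<in> smooth y - A" for n
    using that assms(1)[of "x / real n"] assms(2) by (auto simp: A_def smooth_def divide_simps)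
  ultimately have "(\<lambda>n. f (x / real n)) summable_on (smooth y - A)"
    using summable_on_cong[of "smooth y - A" "\<lambda>n. f (x / real n)"] by simp
  moreover have "(\<lambda>n. f (x / real n)) summable_on A" using \<open>finite A\<close> by simp
  ultimately have "(\<lambda>n. f (x / real n)) summable_on ((smooth y - A) \<union> A)"
    by (intro summable_on_Un_disjoint) auto
  moreover have "(smooth y - A) \<union> A = smooth y" by (auto simp: A_def)
  ultimately show ?thesis by simp
qed

lemma Phi_mu_eq_0:
  assumes "0 < z" "z < 1" "y \<ge> 2"
  shows "Phi z y = 0" "mu y (ln z / ln y) = 0"
proof -
  have "{n::nat. 1 \<le> n \<and> real n \<le> z \<and> (\<forall>p. prime p \<and> p dvd n \<longrightarrow> real p > y)} = {}"
    using assms by force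
  then show "Phi z y = 0" unfolding Phi_def by (simp only: card.empty)
  have "ln z / ln y < 0" using assms by (intro divide_neg_pos) auto
  then show "mu y (ln z / ln y) = 0" by (simp add: mu_def set_lebesgue_integral_def)
qed

lemma summable_on_R:
  assumes "x > 0" "y \<ge> 2"
  shows "(\<lambda>n. Q (x / real n) y) summable_on smooth y"
  by (rule summable_on_smooth_aux[where c = "Pi_prod y - exp (- euler_mascheroni) / ln y"])
    (use assms Phi_mu_eq_0[of _ y] in \<open>auto simp: Q_def V_def Let_def\<close>)

lemma summable_on_R_star:
  assumes "x > 0" "y \<ge> 2"
  shows "(\<lambda>n. Q_star (x / real n) y) summable_on smooth y"
  by (rule summable_on_smooth_aux[where c = 0])
    (use assms Phi_mu_eq_0[of _ y] in \<open>auto simp: Q_star_def V_star_def Let_def\<close>)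

end

theory Submission
  imports Defs
begin

text \<open>
  Fix \<open>y\<close>, substitute \<open>x = y powr v\<close> and divide every quantity by \<open>x\<close>. Integrals such as
  \<open>x \<integral> F (y\<^sup>v) y\<^sup>-\<^sup>v g (u - v) dv\<close> become convolutions \<open>\<star>\<close> of functions on the line that vanish on the
  negative axis and are locally bounded (\<open>causal\<close>). On this class \<open>\<star>\<close> is commutative and associative,
  and multiplication by the variable is a derivation. Write \<open>\<rho>\<close> and \<open>\<omega>\<close> for the functions of Dickman
  and Buchstab, and \<open>\<psi>\<close>, \<open>\<phi>\<close> for the rescaled counts of smooth numbers and of all positive integers.
  
  The first idea is that \<open>\<delta> + \<rho>'\<close> and \<open>\<delta> + \<omega>\<close>, with \<open>\<delta>\<close> the unit mass at \<open>0\<close>, are inverse to each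
  other (\<open>buchstab_conv_dickman_deriv\<close>): the delay equations say that multiplication by the variable
  sends them to \<open>- I \<star> (\<delta> + \<rho>')\<close> and \<open>I \<star> (\<delta> + \<omega>)\<close>, where \<open>I\<close> is the indicator of \<open>[1, \<infinity>)\<close>, so it
  annihilates their product.
  
  The second idea is that both error terms are built from \<open>\<psi>\<close> and \<open>\<phi>\<close>. By definition \<open>\<Lambda>\<close> rescales
  to \<open>(\<delta> + \<rho>') \<star> \<phi>\<close>, so \<open>\<Delta>\<close> rescales to \<open>\<psi> - (\<delta> + \<rho>') \<star> \<phi>\<close> (\<open>Delta_density_eq\<close>). Every positive
  integer is uniquely a smooth times a rough number, so summing \<open>\<Phi> (x / n, y)\<close> over smooth \<open>n\<close> counts
  all integers up to \<open>x\<close>, and \<open>R\<^sup>*\<close> rescales to \<open>(\<delta> + \<omega>) \<star> \<psi> - \<phi>\<close> (\<open>R_star_density_eq\<close>). The two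
  identities between \<open>\<Delta>\<close> and \<open>R\<^sup>*\<close> are then the inversion of \<open>\<delta> + \<rho>'\<close> by \<open>\<delta> + \<omega>\<close>.
  
  Finally \<open>R\<close> rescales to that of \<open>R\<^sup>*\<close> plus a constant \<open>C\<close>. The Euler product over primes up to
  \<open>y\<close> gives \<open>C = 1 - e\<^sup>-\<^sup>\<gamma> \<sigma> / log y\<close> with \<open>\<sigma>\<close> the sum of \<open>1 / n\<close> over smooth \<open>n\<close>. In the identity for
  \<open>\<Delta>\<close>, integrating \<open>C\<close> against \<open>\<rho>'\<close> yields \<open>- C\<close>, because \<open>\<integral> \<rho>' = - 1\<close>. In the identity for \<open>R\<close>
  one needs the integral of the rescaled \<open>\<Delta>\<close> to be \<open>\<sigma> / log y - e\<^sup>\<gamma>\<close> (\<open>integral_Delta_density\<close>), which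
  comes down to \<open>\<integral> \<rho> = e\<^sup>\<gamma>\<close> (\<open>integral_dickman\<close>).
\<close>

section \<open>Convolution of functions supported on the half-line\<close>

text \<open>
  Local boundedness makes the integrand of a convolution bounded with compact support, so that no
  decay at infinity has to be assumed.
\<close>
definition causal :: "(real \<Rightarrow> real) \<Rightarrow> bool" where
  "causal f \<longleftrightarrow> f \<in> borel_measurable borel \<and> (\<forall>t<0. f t = 0) \<and> (\<forall>u. \<exists>B. \<forall>t\<le>u. \<bar>f t\<bar> \<le> B)"

definition conv :: "(real \<Rightarrow> real) \<Rightarrow> (real \<Rightarrow> real) \<Rightarrow> real \<Rightarrow> real" (infixl "\<star>" 75) where
  "(f \<star> g) u = (LINT v|lborel. f v * g (u - v))"

lemma causal_measurable [measurable_dest]: "causal f \<Longrightarrow> f \<in> borel_measurable borel"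
  and causal_neg: "causal f \<Longrightarrow> t < 0 \<Longrightarrow> f t = 0"
  by (auto simp: causal_def)

lemma causal_bound:
  assumes "causal f"
  obtains B where "B \<ge> 0" "\<And>t. t \<le> u \<Longrightarrow> \<bar>f t\<bar> \<le> B"
proof -
  obtain B where B: "\<forall>t\<le>u. \<bar>f t\<bar> \<le> B" using assms unfolding causal_def by blast
  then have "\<bar>f u\<bar> \<le> B" by blast
  then have "B \<ge> 0" by linarith
  then show ?thesis using that B by blast
qed

lemma integrable_bounded_support:
  fixes h :: "'a::euclidean_space \<Rightarrow> real"
  assumes "h \<in> borel_measurable borel" "\<And>t. t \<in> cbox a b \<Longrightarrow> \<bar>h t\<bar> \<le> B" "\<And>t. t \<notin> cbox a b \<Longrightarrow> h t = 0"
  shows "integrable lborel h"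
proof (rule Bochner_Integration.integrable_bound)
  show "integrable lborel (\<lambda>t. indicator (cbox a b) t * B)"
    by (intro integrable_mult_left integrable_real_indicator)
      (use emeasure_bounded_finite[of "cbox a b"] in \<open>auto simp: less_top\<close>)
  show "h \<in> borel_measurable lborel" using assms by simp
  show "AE t in lborel. norm (h t) \<le> norm (indicator (cbox a b) t * B)"
    using assms(2,3) by (intro AE_I2) (fastforce simp: indicator_def)
qed

lemma integrable_conv:
  assumes "causal f" "causal g"
  shows "integrable lborel (\<lambda>v. f v * g (u - v))"
proof -
  note [measurable] = assms[THEN causal_measurable]
  obtain B C where B: "B \<ge> 0" "\<And>t. t \<le> u \<Longrightarrow> \<bar>f t\<bar> \<le> B" and C: "C \<ge> 0" "\<And>t. t \<le> u \<Longrightarrow> \<bar>g t\<bar> \<le> C"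
    using causal_bound[OF assms(1), of u] causal_bound[OF assms(2), of u] by metis
  show ?thesis
  proof (rule integrable_bounded_support)
    show "\<bar>f t * g (u - t)\<bar> \<le> B * C" if "t \<in> cbox 0 u" for t
      unfolding abs_mult using that B C by (intro mult_mono) auto
    show "f t * g (u - t) = 0" if "t \<notin> cbox 0 u" for t
      using that causal_neg[OF assms(1), of t] causal_neg[OF assms(2), of "u - t"] by auto
  qed measurable
qed

lemma conv_neg:
  assumes "causal f" "causal g" "u < 0"
  shows "(f \<star> g) u = 0"
proof -
  have *: "f v * g (u - v) = 0" for v
    using causal_neg[OF assms(1), of v] causal_neg[OF assms(2), of "u - v"] assms(3) by (cases "v < 0") auto
  show ?thesis unfolding conv_def * by simp
qed

lemma causal_conv [intro]:
  assumes "causal f" "causal g"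
  shows "causal (f \<star> g)"
proof -
  note [measurable] = assms[THEN causal_measurable]
  have "(f \<star> g) \<in> borel_measurable borel"
    unfolding conv_def by measurable
  moreover have "\<exists>D. \<forall>t\<le>u. \<bar>(f \<star> g) t\<bar> \<le> D" for u
  proof -
    obtain B C where B: "B \<ge> 0" "\<And>t. t \<le> u \<Longrightarrow> \<bar>f t\<bar> \<le> B" and C: "C \<ge> 0" "\<And>t. t \<le> u \<Longrightarrow> \<bar>g t\<bar> \<le> C"
      using causal_bound[OF assms(1), of u] causal_bound[OF assms(2), of u] by metis
    have "\<bar>(f \<star> g) t\<bar> \<le> (LINT v|lborel. indicator {0..u} v * (B * C))" if "t \<le> u" for t
    proof -
      have "\<bar>(f \<star> g) t\<bar> \<le> (LINT v|lborel. \<bar>f v * g (t - v)\<bar>)"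
        unfolding conv_def by (rule integral_abs_bound)
      also have "\<dots> \<le> (LINT v|lborel. indicator {0..u} v * (B * C))"
      proof (rule integral_mono)
        show "integrable lborel (\<lambda>v. \<bar>f v * g (t - v)\<bar>)"
          using integrable_conv[OF assms] by (rule integrable_abs)
        show "integrable lborel (\<lambda>v. indicator {0..u} v * (B * C))"
          by (intro integrable_mult_left integrable_real_indicator)
            (use emeasure_bounded_finite[of "{0..u}"] in \<open>auto simp: less_top\<close>)
        fix v
        show "\<bar>f v * g (t - v)\<bar> \<le> indicator {0..u} v * (B * C)"
        proof (cases "v \<in> {0..u} \<and> v \<le> t")
          case True
          then show ?thesis using B C that by (auto simp: abs_mult intro!: mult_mono)
        next
          case False
          then have *: "f v * g (t - v) = 0"
            using causal_neg[OF assms(1), of v] causal_neg[OF assms(2), of "t - v"] that by auto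
          show ?thesis unfolding * using B C by simp
        qed
      qed
      finally show ?thesis .
    qed
    then show ?thesis by blast
  qed
  ultimately show ?thesis
    using conv_neg[OF assms] by (auto simp: causal_def)
qed

lemma causal_add [intro]: "causal f \<Longrightarrow> causal g \<Longrightarrow> causal (\<lambda>t. f t + g t)"
proof -
  assume fg: "causal f" "causal g"
  have "\<exists>B. \<forall>t\<le>u. \<bar>f t + g t\<bar> \<le> B" for u
  proof -
    obtain B C where "\<And>t. t \<le> u \<Longrightarrow> \<bar>f t\<bar> \<le> B" and "\<And>t. t \<le> u \<Longrightarrow> \<bar>g t\<bar> \<le> C"
      using causal_bound[OF fg(1), of u] causal_bound[OF fg(2), of u] by metis
    then have "\<forall>t\<le>u. \<bar>f t + g t\<bar> \<le> B + C"
      using abs_triangle_ineq add_mono order_trans by meson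
    then show ?thesis by blast
  qed
  then show ?thesis using fg by (auto simp: causal_def)
qed

lemma causal_mult [intro]:
  assumes "causal f" "h \<in> borel_measurable borel" "\<And>u. \<exists>B. \<forall>t\<in>{0..u}. \<bar>h t\<bar> \<le> B"
  shows "causal (\<lambda>t. h t * f t)"
proof -
  have "\<exists>D. \<forall>t\<le>u. \<bar>h t * f t\<bar> \<le> D" for u
  proof -
    obtain B where B: "B \<ge> 0" "\<And>t. t \<le> u \<Longrightarrow> \<bar>f t\<bar> \<le> B"
      using causal_bound[OF assms(1), of u] by metis
    obtain C where C: "\<forall>t\<in>{0..u}. \<bar>h t\<bar> \<le> C" using assms(3) by blast
    have "\<bar>h t * f t\<bar> \<le> \<bar>C\<bar> * B" if "t \<le> u" for t
    proof (cases "t < 0")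
      case False
      then have "\<bar>h t\<bar> \<le> C" using C that by auto
      then show ?thesis unfolding abs_mult using B that by (intro mult_mono) auto
    qed (use B causal_neg[OF assms(1)] in auto)
    then show ?thesis by blast
  qed
  moreover have "(\<lambda>t. h t * f t) \<in> borel_measurable borel"
    using assms(2) causal_measurable[OF assms(1)] by measurable
  ultimately show ?thesis using causal_neg[OF assms(1)] by (auto simp: causal_def)
qed

lemma causal_cmult [intro]: "causal f \<Longrightarrow> causal (\<lambda>t. c * f t)"
  by (rule causal_mult) auto

lemma causal_minus [intro]: "causal f \<Longrightarrow> causal (\<lambda>t. - f t)"
  using causal_cmult[of f "- 1"] by simp

lemma causal_diff [intro]: "causal f \<Longrightarrow> causal g \<Longrightarrow> causal (\<lambda>t. f t - g t)"
  using causal_add[of f "\<lambda>t. - g t"] causal_minus[of g] by simp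

lemma causal_times_id: "causal f \<Longrightarrow> causal (\<lambda>t. t * f t)"
  by (rule causal_mult) (auto intro: exI[of _ "_::real"])

lemma conv_commute: "f \<star> g = g \<star> f"
proof
  fix u
  have "(f \<star> g) u = (LINT v|lborel. f (u + (-1) * v) * g (u - (u + (-1) * v)))"
    unfolding conv_def by (subst lborel_integral_real_affine[where c = "-1" and t = u]) auto
  then show "(f \<star> g) u = (g \<star> f) u" by (simp add: conv_def mult.commute)
qed

lemma conv_add_left:
  assumes "causal f" "causal g" "causal h"
  shows "((\<lambda>t. f t + g t) \<star> h) u = (f \<star> h) u + (g \<star> h) u"
  unfolding conv_def distrib_right
  by (rule Bochner_Integration.integral_add) (auto intro: integrable_conv assms)

lemma conv_add_right:
  assumes "causal f" "causal g" "causal h"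
  shows "(h \<star> (\<lambda>t. f t + g t)) u = (h \<star> f) u + (h \<star> g) u"
  using conv_add_left[OF assms] by (simp add: conv_commute[of h])

lemma conv_diff_left:
  assumes "causal f" "causal g" "causal h"
  shows "((\<lambda>t. f t - g t) \<star> h) u = (f \<star> h) u - (g \<star> h) u"
  unfolding conv_def left_diff_distrib
  by (rule Bochner_Integration.integral_diff) (auto intro: integrable_conv assms)

lemma conv_diff_right:
  assumes "causal f" "causal g" "causal h"
  shows "(h \<star> (\<lambda>t. f t - g t)) u = (h \<star> f) u - (h \<star> g) u"
  using conv_diff_left[OF assms] by (simp add: conv_commute[of h])

lemma conv_minus_right: "(f \<star> (\<lambda>t. - g t)) u = - (f \<star> g) u"
  by (simp add: conv_def)

text \<open>
  Fubini's theorem, with the inner integral translated. It applies because causality confines the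
  two-dimensional integrand to the square \<open>[0, u] \<times> [0, u]\<close>.
\<close>

lemma conv_assoc:
  assumes "causal f" "causal g" "causal h"
  shows "f \<star> g \<star> h = f \<star> (g \<star> h)"
proof
  fix u
  note [measurable] = assms[THEN causal_measurable]
  define F where "F = (\<lambda>(s, v). f v * g (s - v) * h (u - s))"
  obtain B C D where B: "B \<ge> 0" "\<And>t. t \<le> u \<Longrightarrow> \<bar>f t\<bar> \<le> B" and C: "C \<ge> 0" "\<And>t. t \<le> u \<Longrightarrow> \<bar>g t\<bar> \<le> C"
    and D: "D \<ge> 0" "\<And>t. t \<le> u \<Longrightarrow> \<bar>h t\<bar> \<le> D"
    using causal_bound[OF assms(1), of u] causal_bound[OF assms(2), of u]
      causal_bound[OF assms(3), of u] by metis
  have "integrable lborel F"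
  proof (rule integrable_bounded_support)
    have "F \<in> borel_measurable (borel \<Otimes>\<^sub>M borel)" unfolding F_def by measurable
    then show "F \<in> borel_measurable borel" by (simp add: borel_prod)
    show "\<bar>F t\<bar> \<le> B * C * D" if "t \<in> cbox (0, 0) (u, u)" for t
    proof -
      obtain s v where t: "t = (s, v)" by (cases t)
      then show ?thesis
        unfolding F_def t prod.case abs_mult using that B C D by (intro mult_mono) (auto simp: t)
    qed
    show "F t = 0" if "t \<notin> cbox (0, 0) (u, u)" for t
    proof -
      obtain s v where t: "t = (s, v)" by (cases t)
      have "v < 0 \<or> s - v < 0 \<or> u - s < 0" using that by (auto simp: t)
      then show ?thesis unfolding F_def t
        using causal_neg[OF assms(1), of v] causal_neg[OF assms(2), of "s - v"]
          causal_neg[OF assms(3), of "u - s"] by auto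
    qed
  qed
  then have int: "integrable (lborel \<Otimes>\<^sub>M lborel) (\<lambda>(s, v). f v * g (s - v) * h (u - s))"
    unfolding F_def lborel_prod .
  have "(f \<star> g \<star> h) u = (LINT s|lborel. LINT v|lborel. f v * g (s - v) * h (u - s))"
    unfolding conv_def[of _ h] conv_def[of f g] by (simp add: mult_ac flip: integral_mult_right_zero)
  also have "\<dots> = (LINT v|lborel. LINT s|lborel. f v * g (s - v) * h (u - s))"
    by (rule lborel_pair.Fubini_integral[OF int, symmetric])
  also have "\<dots> = (LINT v|lborel. f v * (g \<star> h) (u - v))"
  proof (rule Bochner_Integration.integral_cong[OF refl])
    fix v
    have "(LINT s|lborel. f v * g (s - v) * h (u - s)) =
        (LINT s|lborel. f v * (g (s - v) * h (u - s)))" by (simp add: mult_ac)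
    also have "\<dots> = f v * (LINT s|lborel. g (s - v) * h (u - s))"
      by simp
    also have "(LINT s|lborel. g (s - v) * h (u - s)) = (g \<star> h) (u - v)"
      unfolding conv_def
      by (subst lborel_integral_real_affine[where c = 1 and t = v]) (auto simp: algebra_simps)
    finally show "(LINT s|lborel. f v * g (s - v) * h (u - s)) = f v * (g \<star> h) (u - v)" .
  qed
  finally show "(f \<star> g \<star> h) u = (f \<star> (g \<star> h)) u" by (simp add: conv_def)
qed

text \<open>
  Write \<open>u = v + (u - v)\<close> inside the integral. This Leibniz rule is what turns the delay equations,
  which are simple only after multiplication by the variable, into statements about convolutions.
\<close>

lemma times_id_conv:
  assumes "causal f" "causal g"
  shows "u * (f \<star> g) u = ((\<lambda>t. t * f t) \<star> g) u + (f \<star> (\<lambda>t. t * g t)) u"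
proof -
  have "((\<lambda>t. t * f t) \<star> g) u + (f \<star> (\<lambda>t. t * g t)) u
      = (LINT v|lborel. v * f v * g (u - v) + f v * ((u - v) * g (u - v)))"
    unfolding conv_def
    by (rule Bochner_Integration.integral_add[symmetric])
      (auto intro!: integrable_conv causal_times_id assms)
  also have "\<dots> = (LINT v|lborel. u * (f v * g (u - v)))"
    by (rule Bochner_Integration.integral_cong) (auto simp: algebra_simps)
  finally show ?thesis by (simp add: conv_def)
qed

definition delay :: "(real \<Rightarrow> real) \<Rightarrow> real \<Rightarrow> real" where
  "delay f t = f (t - 1)"

lemma causal_delay [intro]:
  assumes "causal f"
  shows "causal (delay f)"
proof -
  note [measurable] = causal_measurable[OF assms]
  have "\<exists>B. \<forall>t\<le>u. \<bar>delay f t\<bar> \<le> B" for u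
  proof -
    obtain B where "\<And>t. t \<le> u - 1 \<Longrightarrow> \<bar>f t\<bar> \<le> B" using causal_bound[OF assms, of "u - 1"] by metis
    then show ?thesis by (auto simp: delay_def intro!: exI[of _ B])
  qed
  moreover have "delay f \<in> borel_measurable borel" unfolding delay_def by measurable
  ultimately show ?thesis
    using causal_neg[OF assms] by (auto simp: causal_def delay_def)
qed

lemma delay_conv: "delay f \<star> g = delay (f \<star> g)"
proof
  fix u
  have "(delay f \<star> g) u = (LINT v|lborel. delay f (1 + 1 * v) * g (u - (1 + 1 * v)))"
    unfolding conv_def by (subst lborel_integral_real_affine[where c = 1 and t = 1]) auto
  also have "\<dots> = delay (f \<star> g) u"
    by (simp add: delay_def conv_def algebra_simps)
  finally show "(delay f \<star> g) u = delay (f \<star> g) u" .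
qed

definition heaviside :: "real \<Rightarrow> real" where
  "heaviside = indicator {0..}"

lemma causal_heaviside [intro]: "causal heaviside"
  by (auto simp: causal_def heaviside_def indicator_def intro!: exI[of _ 1])

lemma heaviside_conv: "(heaviside \<star> f) u = (LINT v:{..u}|lborel. f v)"
  unfolding conv_commute[of heaviside] conv_def set_lebesgue_integral_def
  by (rule Bochner_Integration.integral_cong) (auto simp: heaviside_def indicator_def)

lemma set_integral_conv:
  assumes "causal f" "causal g"
  shows "(LBINT v:{0..u}. f v * g (u - v)) = (f \<star> g) u"
    and "set_integrable lborel {0..u} (\<lambda>v. f v * g (u - v))"
proof -
  have *: "indicator {0..u} v *\<^sub>R (f v * g (u - v)) = f v * g (u - v)" for v
    using causal_neg[OF assms(1), of v] causal_neg[OF assms(2), of "u - v"]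
    by (cases "v \<in> {0..u}") auto
  show "(LBINT v:{0..u}. f v * g (u - v)) = (f \<star> g) u"
    by (simp only: set_lebesgue_integral_def conv_def *)
  show "set_integrable lborel {0..u} (\<lambda>v. f v * g (u - v))"
    unfolding set_integrable_def * by (rule integrable_conv[OF assms])
qed

text \<open>
  For integrable functions, in contrast to causal ones, Fubini's theorem is applied on the whole plane.
\<close>

lemma integral_conv:
  assumes "integrable lborel f" "integrable lborel g"
  shows "(LINT u|lborel. (f \<star> g) u) = (LINT t|lborel. f t) * (LINT t|lborel. g t)"
    and "integrable lborel (f \<star> g)"
proof -
  note [measurable] = assms[THEN borel_measurable_integrable]
  have shift: "integrable lborel (\<lambda>u. g (u - v))" "(LINT u|lborel. g (u - v)) = (LINT t|lborel. g t)"
    if "integrable lborel g" for v and g :: "real \<Rightarrow> real"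
  proof -
    show "integrable lborel (\<lambda>u. g (u - v))"
      using lborel_integrable_real_affine[OF that, of 1 "- v"] by simp
    show "(LINT u|lborel. g (u - v)) = (LINT t|lborel. g t)"
      by (subst lborel_integral_real_affine[where c = 1 and t = v]) auto
  qed
  have ag: "integrable lborel (\<lambda>u. \<bar>g u\<bar>)" using assms(2) by (rule integrable_abs)
  have int: "integrable (lborel \<Otimes>\<^sub>M lborel) (\<lambda>(v, u). f v * g (u - v))"
  proof (rule lborel_pair.Fubini_integrable)
    have "(LINT u|lborel. norm (f v * g (u - v))) = \<bar>f v\<bar> * (LINT t|lborel. \<bar>g t\<bar>)" for v
      using shift(2)[OF ag, of v] by (simp add: abs_mult)
    then show "integrable lborel (\<lambda>x. LINT y|lborel. norm (case (x, y) of (v, u) \<Rightarrow> f v * g (u - v)))"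
      using assms(1) by simp
    show "AE x in lborel. integrable lborel (\<lambda>y. case (x, y) of (v, u) \<Rightarrow> f v * g (u - v))"
      using shift(1)[OF assms(2)] by simp
  qed measurable
  have "(LINT u|lborel. (f \<star> g) u) = (LINT v|lborel. LINT u|lborel. f v * g (u - v))"
    unfolding conv_def by (rule lborel_pair.Fubini_integral[OF int])
  also have "\<dots> = (LINT v|lborel. f v * (LINT t|lborel. g t))"
    using shift(2)[OF assms(2)] by simp
  finally show "(LINT u|lborel. (f \<star> g) u) = (LINT t|lborel. f t) * (LINT t|lborel. g t)" by simp
  have "integrable lborel (\<lambda>u. LINT v|lborel. f v * g (u - v))"
    using lborel_pair.integrable_snd[OF int] by simp
  then show "integrable lborel (f \<star> g)" unfolding conv_def .
qed

section \<open>The functions of Dickman and Buchstab as convolutions\<close>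

lemma causal_continuousI:
  assumes "continuous_on {a..} f" "a \<ge> 0" "\<And>t. t < a \<Longrightarrow> f t = 0"
  shows "causal f"
proof -
  have "f = (\<lambda>t. indicator {a..} t *\<^sub>R f t)"
    using assms(3) by (auto simp: indicator_def fun_eq_iff)
  moreover have "(\<lambda>t. indicator {a..} t *\<^sub>R f t) \<in> borel_measurable borel"
    by (rule borel_measurable_continuous_on_indicator[OF _ assms(1)]) auto
  ultimately have "f \<in> borel_measurable borel" by metis
  moreover have "\<exists>B. \<forall>t\<le>u. \<bar>f t\<bar> \<le> B" for u
  proof -
    have "compact (f ` {a..u})"
      by (intro compact_continuous_image continuous_on_subset[OF assms(1)]) auto
    then obtain B where B: "\<And>t. t \<in> {a..u} \<Longrightarrow> \<bar>f t\<bar> \<le> B"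
      by (metis bounded_iff compact_imp_bounded imageI real_norm_def)
    have "\<bar>f t\<bar> \<le> max B 0" if "t \<le> u" for t
      using B[of t] assms(3)[of t] that by (cases "t < a") auto
    then show ?thesis by blast
  qed
  ultimately show ?thesis using assms by (auto simp: causal_def)
qed

text \<open>
  Convolving with the Heaviside function is integration from \<open>0\<close>. The lower end is left at \<open>a\<close> because
  the functions of interest jump at \<open>1\<close>.
\<close>

lemma heaviside_conv_FTC:
  assumes cont: "continuous_on {a..} f" and zero: "\<And>t. t < a \<Longrightarrow> f t = 0"
    and F: "continuous_on {a..} F" "\<And>t. t > a \<Longrightarrow> (F has_real_derivative f t) (at t)"
    and u: "a \<le> u"
  shows "(heaviside \<star> f) u = F u - F a"
proof -
  have "(heaviside \<star> f) u = (LBINT v:{a..u}. f v)"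
    unfolding heaviside_conv set_lebesgue_integral_def
    by (rule Bochner_Integration.integral_cong) (use zero in \<open>auto simp: indicator_def\<close>)
  also have "\<dots> = integral {a..u} f"
    by (rule set_borel_integral_eq_integral(2), rule borel_integrable_atLeastAtMost')
      (rule continuous_on_subset[OF cont], auto)
  also have "\<dots> = F u - F a"
    by (rule integral_unique, rule fundamental_theorem_of_calculus_interior[OF u])
      (use F in \<open>auto intro: continuous_on_subset simp flip: has_real_derivative_iff_has_vector_derivative\<close>)
  finally show ?thesis .
qed

lemma heaviside_conv_heaviside: "heaviside \<star> heaviside = (\<lambda>t. t * heaviside t)"
proof
  fix u
  show "(heaviside \<star> heaviside) u = u * heaviside u"
  proof (cases "u < 0")
    case False
    have "continuous_on {0..} heaviside"
      by (rule continuous_on_eq[of _ "\<lambda>_. 1"]) (auto simp: heaviside_def)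
    then have "(heaviside \<star> heaviside) u = u - 0"
      by (rule heaviside_conv_FTC) (use False in \<open>auto simp: heaviside_def\<close>)
    then show ?thesis using False by (simp add: heaviside_def)
  qed (use conv_neg[of heaviside heaviside u] causal_heaviside in \<open>auto simp: heaviside_def\<close>)
qed

lemma dickman_neg: "u < 0 \<Longrightarrow> dickman u = 0"
  and dickman_unit: "0 \<le> u \<Longrightarrow> u \<le> 1 \<Longrightarrow> dickman u = 1"
  and continuous_on_dickman: "continuous_on {0..} dickman"
  using is_dickman_dickman by (auto simp: is_dickman_def)

text \<open>
  The values prescribed at \<open>0\<close> and \<open>1\<close> by right-continuity are exactly those that make one formula
  hold everywhere, with \<open>0 / 0 = 0\<close> at the origin.
\<close>

lemma dickman_deriv_eq: "dickman_deriv u = - dickman (u - 1) / u"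
proof -
  consider "u = 0" | "u = 1" | "u < 0" | "0 < u" "u < 1" | "u > 1" by linarith
  then show ?thesis
  proof cases
    case 3
    then have "\<forall>\<^sub>F x in nhds u. x \<in> {..<0}" by (intro eventually_nhds_in_open) auto
    then have "\<forall>\<^sub>F x in nhds u. dickman x = 0" by eventually_elim (auto simp: dickman_neg)
    then have "deriv dickman u = deriv (\<lambda>_. 0) u" by (intro deriv_cong_ev) auto
    then show ?thesis using 3 by (simp add: dickman_deriv_def dickman_neg)
  next
    case 4
    then have "\<forall>\<^sub>F x in nhds u. x \<in> {0<..<1}" by (intro eventually_nhds_in_open) auto
    then have "\<forall>\<^sub>F x in nhds u. dickman x = 1" by eventually_elim (auto simp: dickman_unit)
    then have "deriv dickman u = deriv (\<lambda>_. 1) u" by (intro deriv_cong_ev) auto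
    then show ?thesis using 4 by (simp add: dickman_deriv_def dickman_neg)
  next
    case 5
    then show ?thesis
      using DERIV_imp_deriv[OF is_dickman_derivI[OF is_dickman_dickman, of u]]
      by (simp add: dickman_deriv_def)
  qed (auto simp: dickman_unit)
qed

lemma dickman_deriv_below: "u < 1 \<Longrightarrow> dickman_deriv u = 0"
  by (simp add: dickman_deriv_eq dickman_neg)

lemma continuous_on_dickman_deriv: "continuous_on {1..} dickman_deriv"
proof (rule continuous_on_eq)
  show "continuous_on {1..} (\<lambda>u. - dickman (u - 1) / u)"
    by (intro continuous_intros continuous_on_compose2[OF continuous_on_dickman]) auto
qed (simp add: dickman_deriv_eq)

lemma causal_dickman [intro]: "causal dickman"
  by (rule causal_continuousI[OF continuous_on_dickman]) (auto simp: dickman_neg)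

lemma causal_dickman_deriv [intro]: "causal dickman_deriv"
  by (rule causal_continuousI[OF continuous_on_dickman_deriv]) (auto simp: dickman_deriv_below)

lemma buchstab_below: "u < 1 \<Longrightarrow> buchstab u = 0"
  and buchstab_base: "1 \<le> u \<Longrightarrow> u \<le> 2 \<Longrightarrow> buchstab u = 1 / u"
  and continuous_on_buchstab: "continuous_on {1..} buchstab"
  and buchstab_deriv: "u > 2 \<Longrightarrow> ((\<lambda>t. t * buchstab t) has_real_derivative buchstab (u - 1)) (at u)"
  using is_buchstab_buchstab by (auto simp: is_buchstab_def)

lemma causal_buchstab [intro]: "causal buchstab"
  by (rule causal_continuousI[OF continuous_on_buchstab]) (auto simp: buchstab_below)

lemma dickman_eq_heaviside_conv: "dickman u = heaviside u + (heaviside \<star> dickman_deriv) u"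
proof (cases "u < 1")
  case True
  have *: "heaviside v * dickman_deriv (u - v) = 0" for v
    using True by (auto simp: heaviside_def dickman_deriv_below indicator_def)
  show ?thesis
    unfolding conv_def * using True
    by (cases "u < 0") (auto simp: heaviside_def dickman_neg dickman_unit)
next
  case False
  have "(heaviside \<star> dickman_deriv) u = dickman u - dickman 1"
  proof (rule heaviside_conv_FTC[OF continuous_on_dickman_deriv])
    show "continuous_on {1..} dickman" by (rule continuous_on_subset[OF continuous_on_dickman]) auto
    show "(dickman has_real_derivative dickman_deriv t) (at t)" if "t > 1" for t
      unfolding dickman_deriv_eq by (rule is_dickman_derivI[OF is_dickman_dickman that])
  qed (use False in \<open>auto simp: dickman_deriv_below\<close>)
  then show ?thesis using False by (simp add: heaviside_def dickman_unit)
qed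

lemma times_id_dickman_deriv: "u * dickman_deriv u = - delay dickman u"
  by (cases "u = 0") (auto simp: dickman_deriv_eq delay_def dickman_neg)

lemma times_id_buchstab: "u * buchstab u = delay heaviside u + (delay heaviside \<star> buchstab) u"
proof -
  have "(heaviside \<star> buchstab) (u - 1) = u * buchstab u - delay heaviside u"
  proof (cases "u < 2")
    case True
    have *: "heaviside v * buchstab (u - 1 - v) = 0" for v
      using True by (auto simp: heaviside_def buchstab_below indicator_def)
    show ?thesis
      unfolding conv_def * using True
      by (cases "u < 1") (auto simp: heaviside_def buchstab_below buchstab_base delay_def)
  next
    case False
    have "(heaviside \<star> buchstab) (u - 1) =
        (\<lambda>t. (t + 1) * buchstab (t + 1)) (u - 1) - (\<lambda>t. (t + 1) * buchstab (t + 1)) 1"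
    proof (rule heaviside_conv_FTC[OF continuous_on_buchstab])
      show "continuous_on {1..} (\<lambda>t. (t + 1) * buchstab (t + 1))"
        by (intro continuous_intros continuous_on_compose2[OF continuous_on_buchstab]) auto
      show "((\<lambda>t. (t + 1) * buchstab (t + 1)) has_real_derivative buchstab t) (at t)" if "t > 1" for t
        using buchstab_deriv[of "t + 1"] that DERIV_shift[of "\<lambda>t. t * buchstab t" _ t 1] by simp
    qed (use False in \<open>auto simp: buchstab_below\<close>)
    then show ?thesis using False by (simp add: heaviside_def delay_def buchstab_base)
  qed
  then show ?thesis by (simp add: delay_conv) (simp add: delay_def)
qed

text \<open>
  This is \<open>(\<delta> + \<omega>) \<star> (\<delta> + \<rho>') = \<delta>\<close> with the unit masses expanded. Multiplying the left-hand side by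
  \<open>u\<close> and using the Leibniz rule, the contributions of the two delay equations cancel, which settles
  every \<open>u \<noteq> 0\<close>; at \<open>0\<close> all terms vanish.
\<close>

theorem buchstab_conv_dickman_deriv:
  "buchstab u + dickman_deriv u + (buchstab \<star> dickman_deriv) u = 0"
proof (cases "u = 0")
  case True
  have *: "buchstab v * dickman_deriv (u - v) = 0" for v
    using True by (cases "v < 1") (auto simp: buchstab_below dickman_deriv_below)
  show ?thesis unfolding conv_def * by (simp add: True buchstab_below)
next
  case False
  let ?I = "delay heaviside"
  have I: "causal ?I" by auto
  have c: "causal (?I \<star> buchstab)" "causal (?I \<star> dickman_deriv)" using I by auto
  have w: "(\<lambda>t. t * buchstab t) = (\<lambda>t. ?I t + (?I \<star> buchstab) t)"
    by (simp add: times_id_buchstab)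
  have "dickman = (\<lambda>t. heaviside t + (heaviside \<star> dickman_deriv) t)"
    by (simp add: dickman_eq_heaviside_conv fun_eq_iff)
  then have "delay dickman t = ?I t + (?I \<star> dickman_deriv) t" for t
    unfolding delay_conv unfolding delay_def by metis
  then have r: "(\<lambda>t. t * dickman_deriv t) = (\<lambda>t. - (?I t + (?I \<star> dickman_deriv) t))"
    by (simp add: times_id_dickman_deriv)
  have "u * (buchstab \<star> dickman_deriv) u =
      (?I \<star> dickman_deriv) u + (?I \<star> buchstab \<star> dickman_deriv) u
      - ((buchstab \<star> ?I) u + (buchstab \<star> (?I \<star> dickman_deriv)) u)"
    unfolding times_id_conv[OF causal_buchstab causal_dickman_deriv] w r conv_minus_right
    using I c causal_buchstab causal_dickman_deriv by (simp add: conv_add_left conv_add_right)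
  also have "buchstab \<star> (?I \<star> dickman_deriv) = ?I \<star> buchstab \<star> dickman_deriv"
    using I causal_buchstab causal_dickman_deriv
    by (metis conv_assoc conv_commute)
  also have "buchstab \<star> ?I = ?I \<star> buchstab" by (rule conv_commute)
  finally have "u * (buchstab u + dickman_deriv u + (buchstab \<star> dickman_deriv) u) = 0"
    using fun_cong[OF w, of u] fun_cong[OF r, of u] by (simp add: distrib_left)
  then show ?thesis using False by simp
qed

section \<open>Size of Dickman's function\<close>

definition block :: "real \<Rightarrow> real" where
  "block = indicator {0..<1}"

lemma causal_block [intro]: "causal block"
  by (auto simp: causal_def block_def indicator_def intro!: exI[of _ 1])

lemma integrable_block: "integrable lborel block"
  and integral_block: "integral\<^sup>L lborel block = 1"
  by (simp_all add: block_def)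

text \<open>
  The delay equation in integrated form, \<open>u \<rho>(u) = \<integral> \<rho>\<close> over \<open>[u - 1, u]\<close>. It yields the sign, the
  decay and the Laplace transform of \<open>\<rho>\<close>.
\<close>

lemma times_id_dickman: "u * dickman u = (block \<star> dickman) u"
proof -
  have d: "dickman = (\<lambda>t. heaviside t + (heaviside \<star> dickman_deriv) t)"
    by (simp add: dickman_eq_heaviside_conv fun_eq_iff)
  have c: "causal heaviside" "causal dickman_deriv" "causal (heaviside \<star> dickman_deriv)"
    "causal dickman" "causal (delay heaviside)" by auto
  have r: "(\<lambda>t. t * dickman_deriv t) = (\<lambda>t. - delay dickman t)"
    by (simp add: times_id_dickman_deriv)
  have "u * dickman u = u * heaviside u + u * (heaviside \<star> dickman_deriv) u"
    by (simp add: dickman_eq_heaviside_conv distrib_left)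
  also have "\<dots> = (heaviside \<star> heaviside) u + (heaviside \<star> heaviside \<star> dickman_deriv) u
      - (heaviside \<star> delay dickman) u"
    unfolding times_id_conv[OF c(1,2)] r heaviside_conv_heaviside[symmetric] conv_minus_right
    by (simp add: heaviside_conv_heaviside)
  also have "heaviside \<star> heaviside \<star> dickman_deriv = heaviside \<star> (heaviside \<star> dickman_deriv)"
    using c by (simp add: conv_assoc)
  also have "(heaviside \<star> heaviside) u + (heaviside \<star> (heaviside \<star> dickman_deriv)) u
      = (heaviside \<star> dickman) u"
    using conv_add_right[OF c(1,3,1), of u] by (simp flip: d)
  also have "heaviside \<star> delay dickman = delay heaviside \<star> dickman"
    by (metis conv_commute delay_conv)
  also have "(heaviside \<star> dickman) u - (delay heaviside \<star> dickman) u = (block \<star> dickman) u"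
  proof -
    have "block = (\<lambda>t. heaviside t - delay heaviside t)"
      by (auto simp: fun_eq_iff block_def heaviside_def delay_def indicator_def)
    then show ?thesis using conv_diff_left[OF c(1,5,4), of u] by simp
  qed
  finally show ?thesis .
qed

text \<open>
  Sign and monotonicity have to be advanced together: if \<open>\<rho> \<ge> 0\<close> up to \<open>n\<close>, then \<open>\<rho>' \<le> 0\<close> up to
  \<open>n + 1\<close>, and a decreasing \<open>\<rho>\<close> satisfies \<open>u \<rho>(u) \<ge> \<rho>(u)\<close>, which for \<open>u > 1\<close> excludes negative
  values.
\<close>

lemma dickman_nonneg_antimono_aux:
  "\<forall>u\<in>{0..real n + 1}. dickman u \<ge> 0 \<and> (\<forall>v\<in>{0..u}. dickman u \<le> dickman v)"
proof (induction n)
  case 0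
  then show ?case by (auto simp: dickman_unit)
next
  case (Suc n)
  have anti1: "dickman u \<le> dickman v" if "1 \<le> v" "v \<le> u" "u \<le> real (Suc n) + 1" for u v
  proof (rule DERIV_nonpos_imp_decreasing_open[OF that(2)])
    show "continuous_on {v..u} dickman"
      by (rule continuous_on_subset[OF continuous_on_dickman]) (use that in auto)
    fix x assume x: "v < x" "x < u"
    then have "dickman (x - 1) \<ge> 0" using Suc that by auto
    then show "\<exists>y. (dickman has_real_derivative y) (at x) \<and> y \<le> 0"
      using is_dickman_derivI[OF is_dickman_dickman, of x] x that
      by (intro exI[of _ "- dickman (x - 1) / x"]) auto
  qed
  have anti: "dickman u \<le> dickman v" if "0 \<le> v" "v \<le> u" "u \<le> real (Suc n) + 1" for u v
    using anti1[of v u] anti1[of 1 u] that dickman_unit[of u] dickman_unit[of v] dickman_unit[of 1]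
    by (cases "v \<le> 1"; cases "u \<le> 1") auto
  have "dickman u \<ge> 0" if u: "1 < u" "u \<le> real (Suc n) + 1" for u
  proof -
    have "dickman u = (LINT v|lborel. block v * dickman u)" by (simp add: integral_block)
    also have "\<dots> \<le> (LINT v|lborel. block v * dickman (u - v))"
    proof (rule integral_mono)
      fix v show "block v * dickman u \<le> block v * dickman (u - v)"
        using anti[of "u - v" u] u by (auto simp: block_def indicator_def)
    qed (auto intro: integrable_conv integrable_block)
    also have "\<dots> = u * dickman u" by (simp add: times_id_dickman conv_def)
    finally have "0 \<le> (u - 1) * dickman u" by (simp add: algebra_simps)
    then show ?thesis using u by (simp add: zero_le_mult_iff)
  qed
  then have "dickman u \<ge> 0" if u: "0 \<le> u" "u \<le> real (Suc n) + 1" for u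
    using dickman_unit[of u] that by (cases "u \<le> 1") auto
  then show ?case using anti by auto
qed

lemma dickman_nonneg: "dickman u \<ge> 0"
proof (cases "u < 0")
  case False
  then show ?thesis
    using dickman_nonneg_antimono_aux[of "nat \<lceil>u\<rceil>"] by (auto simp: real_nat_ceiling_ge add_increasing2)
qed (simp add: dickman_neg)

lemma dickman_antimono:
  assumes "0 \<le> v" "v \<le> u"
  shows "dickman u \<le> dickman v"
proof -
  have "u \<le> real (nat \<lceil>u\<rceil>) + 1" by linarith
  then show ?thesis
    using dickman_nonneg_antimono_aux[of "nat \<lceil>u\<rceil>"] assms by auto
qed

lemma dickman_le_1: "dickman u \<le> 1"
  using dickman_antimono[of 0 u] dickman_unit[of 0] dickman_neg[of u] by (cases "u < 0") auto

text \<open>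
  Monotonicity in the integrated delay equation gives \<open>u \<rho>(u) \<le> \<rho>(u - 1)\<close>, so beyond \<open>u = 3 \<ge> e\<close>
  each unit step costs at least a factor \<open>e\<close>.
\<close>

lemma dickman_le_exp: "dickman u \<le> exp (3 - u)"
proof -
  have step: "u * dickman u \<le> dickman (u - 1)" if "u \<ge> 1" for u
  proof -
    have "u * dickman u = (LINT v|lborel. block v * dickman (u - v))"
      by (simp add: times_id_dickman conv_def)
    also have "\<dots> \<le> (LINT v|lborel. block v * dickman (u - 1))"
    proof (rule integral_mono)
      fix v show "block v * dickman (u - v) \<le> block v * dickman (u - 1)"
        using dickman_antimono[of "u - 1" "u - v"] that by (auto simp: block_def indicator_def)
    qed (auto intro: integrable_conv integrable_block)
    finally show ?thesis by (simp add: integral_block)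
  qed
  have "\<forall>u\<le>real n + 3. dickman u \<le> exp (3 - u)" for n
  proof (induction n)
    case 0
    have "dickman u \<le> exp (3 - u)" if "u \<le> 3" for u
      using dickman_le_1[of u] that order_trans by fastforce
    then show ?case by auto
  next
    case (Suc n)
    show ?case
    proof (intro allI impI)
      fix u assume u: "u \<le> real (Suc n) + 3"
      show "dickman u \<le> exp (3 - u)"
      proof (cases "u \<le> real n + 3")
        case False
        then have "exp 1 * dickman u \<le> u * dickman u"
          using exp_le dickman_nonneg[of u] by (intro mult_right_mono) auto
        also have "\<dots> \<le> dickman (u - 1)" using step False by simp
        also have "\<dots> \<le> exp (3 - (u - 1))" using Suc[rule_format, of "u - 1"] u by simp
        also have "\<dots> = exp 1 * exp (3 - u)" by (simp flip: exp_add)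
        finally show ?thesis by simp
      qed (use Suc in blast)
    qed
  qed
  moreover have "u \<le> real (nat \<lceil>u\<rceil>) + 3" by linarith
  ultimately show ?thesis by blast
qed

lemma has_bochner_integral_exp_tail:
  fixes a c :: real
  assumes "a > 0"
  shows "has_bochner_integral lborel (\<lambda>t. indicator {c..} t * exp (- a * t)) (exp (- a * c) / a)"
proof (rule has_bochner_integral_nn_integral)
  have "(\<integral>\<^sup>+t. ennreal (exp (- a * t)) * indicator {c..} t \<partial>lborel) = ennreal (0 - (- exp (- a * c) / a))"
  proof (rule nn_integral_FTC_atLeast)
    show "((\<lambda>t. - exp (- a * t) / a) has_real_derivative exp (- a * t)) (at t)" if "c \<le> t" for t
      using assms by (auto intro!: derivative_eq_intros)
    have "filterlim (\<lambda>t. - a * t) at_bot at_top"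
      using assms by (intro filterlim_tendsto_neg_mult_at_bot[OF tendsto_const] filterlim_ident) auto
    then have "((\<lambda>t. - exp (- a * t) / a) \<longlongrightarrow> - 0 / a) at_top"
      by (intro tendsto_intros filterlim_compose[OF exp_at_bot]) (use assms in auto)
    then show "((\<lambda>t. - exp (- a * t) / a) \<longlongrightarrow> 0) at_top" by simp
  qed auto
  moreover have "ennreal (indicator {c..} t * exp (- a * t)) = ennreal (exp (- a * t)) * indicator {c..} t" for t
    by (auto simp: indicator_def)
  ultimately show "(\<integral>\<^sup>+t. ennreal (indicator {c..} t * exp (- a * t)) \<partial>lborel) = ennreal (exp (- a * c) / a)"
    by simp
qed (use assms in auto)

lemma integrable_exp_decay:
  fixes f :: "real \<Rightarrow> real"
  assumes "f \<in> borel_measurable borel" "\<And>t. t < c \<Longrightarrow> f t = 0" "a > 0"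
    "\<And>t. t \<ge> c \<Longrightarrow> \<bar>f t\<bar> \<le> B * exp (- a * t)"
  shows "integrable lborel f"
proof (rule Bochner_Integration.integrable_bound)
  show "integrable lborel (\<lambda>t. B * (indicator {c..} t * exp (- a * t)))"
    using has_bochner_integral_exp_tail[OF assms(3), of c]
    by (intro integrable_mult_right) (simp add: has_bochner_integral_iff)
  show "AE t in lborel. norm (f t) \<le> norm (B * (indicator {c..} t * exp (- a * t)))"
  proof (rule AE_I2)
    fix t
    show "norm (f t) \<le> norm (B * (indicator {c..} t * exp (- a * t)))"
      using assms(2)[of t] assms(4)[of t] by (cases "t < c") auto
  qed
qed (use assms in auto)

lemma integrable_dickman: "integrable lborel dickman"
proof (rule integrable_exp_decay[where c = 0 and a = 1 and B = "exp 3"])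
  show "\<bar>dickman t\<bar> \<le> exp 3 * exp (- 1 * t)" for t
    using dickman_le_exp[of t] dickman_nonneg[of t] by (simp flip: exp_add)
qed (use causal_dickman causal_neg causal_measurable in auto)

lemma integrable_square_times_dickman: "integrable lborel (\<lambda>t. t\<^sup>2 * dickman t)"
proof (rule integrable_exp_decay[where c = 0 and a = "1 / 2" and B = "16 * exp 3"])
  note [measurable] = causal_measurable[OF causal_dickman]
  show "(\<lambda>t. t\<^sup>2 * dickman t) \<in> borel_measurable borel" by measurable
  fix t :: real assume t: "t \<ge> 0"
  have "t / 4 \<le> exp (t / 4)" using exp_ge_add_one_self[of "t / 4"] by linarith
  then have "(t / 4)\<^sup>2 \<le> (exp (t / 4))\<^sup>2" using t by (intro power_mono) auto
  also have "\<dots> = exp (t / 2)" by (simp flip: exp_double)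
  finally have "t\<^sup>2 \<le> 16 * exp (t / 2)" by (simp add: power_divide)
  then have "t\<^sup>2 * dickman t \<le> 16 * exp (t / 2) * exp (3 - t)"
    using dickman_le_exp[of t] dickman_nonneg[of t] by (intro mult_mono) auto
  also have "\<dots> = 16 * exp 3 * exp (- (1 / 2) * t)"
    by (simp add: mult.assoc flip: exp_add)
  finally show "\<bar>t\<^sup>2 * dickman t\<bar> \<le> 16 * exp 3 * exp (- (1 / 2) * t)"
    using dickman_nonneg[of t] by (simp add: abs_mult)
qed (auto simp: dickman_neg)

lemma integrable_dickman_deriv: "integrable lborel dickman_deriv"
proof (rule Bochner_Integration.integrable_bound)
  show "integrable lborel (\<lambda>t. dickman (t - 1))"
    using lborel_integrable_real_affine[OF integrable_dickman, of 1 "- 1"] by simp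
  show "AE t in lborel. norm (dickman_deriv t) \<le> norm (dickman (t - 1))"
  proof (rule AE_I2)
    fix t
    show "norm (dickman_deriv t) \<le> norm (dickman (t - 1))"
      using dickman_nonneg[of "t - 1"]
      by (cases "t < 1") (auto simp: dickman_deriv_eq dickman_neg divide_le_eq mult_le_cancel_left1)
  qed
qed (use causal_measurable[OF causal_dickman_deriv] in auto)

lemma tendsto_dickman_at_top: "(dickman \<longlongrightarrow> 0) at_top"
proof (rule tendsto_sandwich[where f = "\<lambda>_. 0" and h = "\<lambda>u. exp (3 - u)"])
  have "((\<lambda>u::real. exp 3 * exp (- u)) \<longlongrightarrow> 0) at_top"
    by (intro tendsto_mult_right_zero filterlim_compose[OF exp_at_bot filterlim_uminus_at_bot_at_top])
  then show "((\<lambda>u. exp (3 - u)) \<longlongrightarrow> (0::real)) at_top"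
    by (simp flip: exp_add)
qed (auto intro!: always_eventually dickman_nonneg dickman_le_exp)

text \<open>
  The integral up to \<open>u\<close> is \<open>\<rho>(u) - \<rho>(0)\<close>, and \<open>\<rho>\<close> tends to \<open>0\<close>.
\<close>

lemma integral_dickman_deriv: "integral\<^sup>L lborel dickman_deriv = - 1"
proof (rule tendsto_unique[OF trivial_limit_at_top_linorder])
  show "((\<lambda>u. LINT v|lborel. indicator {..u} v *\<^sub>R dickman_deriv v) \<longlongrightarrow> integral\<^sup>L lborel dickman_deriv) at_top"
    by (rule tendsto_integral_at_top) (use integrable_dickman_deriv in auto)
  have "\<forall>\<^sub>F u in at_top. dickman u - 1 = (LINT v|lborel. indicator {..u} v *\<^sub>R dickman_deriv v)"
    using eventually_ge_at_top[of 0]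
  proof eventually_elim
    case (elim u)
    then show ?case
      using dickman_eq_heaviside_conv[of u]
      by (simp add: heaviside_conv set_lebesgue_integral_def) (simp add: heaviside_def)
  qed
  moreover have "((\<lambda>u. dickman u - 1) \<longlongrightarrow> 0 - 1) at_top"
    by (intro tendsto_intros tendsto_dickman_at_top)
  ultimately show "((\<lambda>u. LINT v|lborel. indicator {..u} v *\<^sub>R dickman_deriv v) \<longlongrightarrow> - 1) at_top"
    using Lim_transform_eventually by fastforce
qed

section \<open>The integral of Dickman's function\<close>

definition laplace :: "(real \<Rightarrow> real) \<Rightarrow> real \<Rightarrow> real" where
  "laplace f s = (LINT t|lborel. f t * exp (- s * t))"

lemma integrable_laplace:
  fixes f :: "real \<Rightarrow> real"
  assumes "integrable lborel f" "\<And>t. t < 0 \<Longrightarrow> f t = 0" "s \<ge> 0"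
  shows "integrable lborel (\<lambda>t. f t * exp (- s * t))"
proof (rule Bochner_Integration.integrable_bound[OF assms(1)])
  note [measurable] = borel_measurable_integrable[OF assms(1)]
  show "(\<lambda>t. f t * exp (- s * t)) \<in> borel_measurable lborel" by measurable
  show "AE t in lborel. norm (f t * exp (- s * t)) \<le> norm (f t)"
  proof (rule AE_I2)
    fix t
    show "norm (f t * exp (- s * t)) \<le> norm (f t)"
      using assms(2)[of t] assms(3) by (cases "t < 0") (auto simp: abs_mult mult_left_le)
  qed
qed

text \<open>
  A second-order bound for \<open>exp (- t)\<close> that is uniform in \<open>p\<close> and \<open>q\<close>, so that it can be integrated
  in order to differentiate a Laplace transform.
\<close>

lemma exp_minus_linear_approx:
  fixes p q :: real
  assumes "p \<ge> 0" "q \<ge> 0"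
  shows "\<bar>exp (- q) - exp (- p) + (q - p) * exp (- p)\<bar> \<le> (q - p)\<^sup>2"
proof -
  define d where "d = q - p"
  have e: "exp (- q) - exp (- p) + (q - p) * exp (- p) = exp (- p) * (exp (- d) - (1 - d))"
    by (simp add: d_def algebra_simps flip: exp_add)
  have "exp (- d) \<ge> 1 - d" using exp_ge_add_one_self[of "- d"] by simp
  moreover have "exp (- p) * (exp (- d) - (1 - d)) \<le> d\<^sup>2"
  proof (cases "d \<ge> 0")
    case True
    have "exp (- d) \<le> 1 / (1 + d)"
      using exp_ge_add_one_self[of d] True by (simp add: exp_minus field_simps)
    also have "\<dots> \<le> 1 - d + d\<^sup>2"
      using True by (simp add: field_simps power2_eq_square)
    finally have "exp (- d) - (1 - d) \<le> d\<^sup>2" by simp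
    moreover have "exp (- p) \<le> 1" using assms by simp
    ultimately show ?thesis
      using mult_mono[of "exp (- p)" 1 "exp (- d) - (1 - d)" "d\<^sup>2"] \<open>exp (- d) \<ge> 1 - d\<close> by simp
  next
    case False
    have "exp (- p) * (exp (- d) - (1 - d)) = exp (- q) * (1 - (1 - d) * exp d)"
      by (simp add: d_def algebra_simps flip: exp_add)
    also have "\<dots> \<le> 1 * d\<^sup>2"
    proof (rule mult_mono)
      have *: "(1 - d) * (1 + d) \<le> (1 - d) * exp d"
        using exp_ge_add_one_self[of d] False by (intro mult_left_mono) auto
      then show "1 - (1 - d) * exp d \<le> d\<^sup>2" by (simp add: algebra_simps power2_eq_square)
      have "(1 - d) * exp d \<le> exp (- d) * exp d"
        using \<open>exp (- d) \<ge> 1 - d\<close> by (intro mult_right_mono) auto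
      then show "0 \<le> 1 - (1 - d) * exp d" by (simp flip: exp_add)
    qed (use assms in auto)
    finally show ?thesis by simp
  qed
  ultimately show ?thesis unfolding e by (simp add: d_def abs_mult)
qed

lemma integrable_first_moment:
  fixes f :: "real \<Rightarrow> real"
  assumes "integrable lborel f" "integrable lborel (\<lambda>t. t\<^sup>2 * f t)"
  shows "integrable lborel (\<lambda>t. t * f t)"
proof (rule Bochner_Integration.integrable_bound)
  note [measurable] = borel_measurable_integrable[OF assms(1)]
  show "integrable lborel (\<lambda>t. \<bar>f t\<bar> + \<bar>t\<^sup>2 * f t\<bar>)"
    using assms by (intro Bochner_Integration.integrable_add integrable_abs)
  show "(\<lambda>t. t * f t) \<in> borel_measurable lborel" by measurable
  have "\<bar>t\<bar> \<le> 1 + t\<^sup>2" for t :: real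
    using zero_le_power2[of "\<bar>t\<bar> - 1"] by (simp add: power2_diff)
  then have "\<bar>t\<bar> * \<bar>f t\<bar> \<le> (1 + t\<^sup>2) * \<bar>f t\<bar>" for t by (intro mult_right_mono) auto
  then show "AE t in lborel. norm (t * f t) \<le> norm (\<bar>f t\<bar> + \<bar>t\<^sup>2 * f t\<bar>)"
    by (intro AE_I2) (simp add: abs_mult algebra_simps)
qed

text \<open>
  Two finite moments bound the error of the linear approximation by \<open>(b - s)\<^sup>2 \<integral> t\<^sup>2 \<bar>f t\<bar> dt\<close>. The
  derivative is one-sided at \<open>s = 0\<close>, which is the point of interest.
\<close>

lemma laplace_has_derivative:
  assumes f: "integrable lborel f" "integrable lborel (\<lambda>t. t\<^sup>2 * f t)" "\<And>t. t < 0 \<Longrightarrow> f t = 0"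
    and s: "s \<ge> 0"
  shows "(laplace f has_real_derivative - laplace (\<lambda>t. t * f t) s) (at s within {0..})"
  unfolding has_field_derivative_iff
proof (rule Lim_transform)
  define C where "C = (LINT t|lborel. \<bar>t\<^sup>2 * f t\<bar>)"
  note f1 = integrable_first_moment[OF f(1,2)]
  have bound: "\<bar>laplace f b - laplace f s + (b - s) * laplace (\<lambda>t. t * f t) s\<bar> \<le> (b - s)\<^sup>2 * C"
    if b: "b \<ge> 0" for b
  proof -
    have i: "integrable lborel (\<lambda>t. f t * exp (- b * t))" "integrable lborel (\<lambda>t. f t * exp (- s * t))"
      "integrable lborel (\<lambda>t. t * f t * exp (- s * t))"
      using integrable_laplace[OF f(1,3) b] integrable_laplace[OF f(1,3) s]
        integrable_laplace[OF f1 _ s] f(3) by simp_all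
    let ?h = "\<lambda>t. f t * exp (- b * t) - f t * exp (- s * t) + (b - s) * (t * f t * exp (- s * t))"
    have ih: "integrable lborel ?h"
      by (intro Bochner_Integration.integrable_add Bochner_Integration.integrable_diff integrable_mult_right i)
    have L: "laplace f b - laplace f s + (b - s) * laplace (\<lambda>t. t * f t) s = (LINT t|lborel. ?h t)"
      unfolding laplace_def using i
      by (simp only: Bochner_Integration.integral_add Bochner_Integration.integral_diff
          Bochner_Integration.integrable_diff integral_mult_right_zero integrable_mult_right)
    have "\<bar>LINT t|lborel. ?h t\<bar> \<le> (LINT t|lborel. \<bar>?h t\<bar>)" by (rule integral_abs_bound)
    also have "\<dots> \<le> (LINT t|lborel. (b - s)\<^sup>2 * \<bar>t\<^sup>2 * f t\<bar>)"
    proof (rule integral_mono)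
      show "integrable lborel (\<lambda>t. \<bar>?h t\<bar>)" using ih by (rule integrable_abs)
      show "integrable lborel (\<lambda>t. (b - s)\<^sup>2 * \<bar>t\<^sup>2 * f t\<bar>)"
        by (intro integrable_mult_right integrable_abs f)
      fix t
      show "\<bar>?h t\<bar> \<le> (b - s)\<^sup>2 * \<bar>t\<^sup>2 * f t\<bar>"
      proof (cases "t < 0")
        case False
        have h: "?h t = f t * (exp (- (b * t)) - exp (- (s * t)) + (b * t - s * t) * exp (- (s * t)))"
          by (simp add: algebra_simps)
        have "\<bar>?h t\<bar> \<le> \<bar>f t\<bar> * (b * t - s * t)\<^sup>2"
          unfolding h
          unfolding abs_mult using False b s
          by (intro mult_left_mono exp_minus_linear_approx) auto
        also have "\<bar>f t\<bar> * (b * t - s * t)\<^sup>2 = (b - s)\<^sup>2 * \<bar>t\<^sup>2 * f t\<bar>"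
        proof -
          have "(b * t - s * t)\<^sup>2 = (b - s)\<^sup>2 * t\<^sup>2"
            by (simp flip: left_diff_distrib add: power_mult_distrib)
          then show ?thesis by (simp add: abs_mult)
        qed
        finally show ?thesis .
      qed (simp add: f)
    qed
    finally show ?thesis unfolding L by (simp add: C_def)
  qed
  show "((\<lambda>b. - laplace (\<lambda>t. t * f t) s) \<longlongrightarrow> - laplace (\<lambda>t. t * f t) s) (at s within {0..})"
    by simp
  have "((\<lambda>b. \<bar>b - s\<bar> * C) \<longlongrightarrow> \<bar>s - s\<bar> * C) (at s within {0..})"
    by (intro tendsto_intros)
  then have lim: "((\<lambda>b. \<bar>b - s\<bar> * C) \<longlongrightarrow> 0) (at s within {0..})" by simp
  show "((\<lambda>b. (laplace f b - laplace f s) / (b - s) - - laplace (\<lambda>t. t * f t) s) \<longlongrightarrow> 0)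
      (at s within {0..})"
  proof (rule Lim_null_comparison[OF _ lim])
    have "norm ((laplace f b - laplace f s) / (b - s) - - laplace (\<lambda>t. t * f t) s) \<le> \<bar>b - s\<bar> * C"
      if b: "b \<ge> 0" "b \<noteq> s" for b
    proof -
      have q: "(laplace f b - laplace f s) / (b - s) - - laplace (\<lambda>t. t * f t) s =
          (laplace f b - laplace f s + (b - s) * laplace (\<lambda>t. t * f t) s) / (b - s)"
        using b by (simp add: add_divide_distrib)
      have "\<bar>(laplace f b - laplace f s) / (b - s) - - laplace (\<lambda>t. t * f t) s\<bar> \<le> (b - s)\<^sup>2 * C / \<bar>b - s\<bar>"
        unfolding q abs_divide using bound[OF b(1)] by (intro divide_right_mono) auto
      also have "\<dots> = \<bar>b - s\<bar> * C"
      proof -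
        have "d\<^sup>2 * C / d = d * C" if "d \<noteq> 0" for d :: real
          using that by (simp add: power2_eq_square)
        from this[of "\<bar>b - s\<bar>"] show ?thesis using b by simp
      qed
      finally show ?thesis unfolding real_norm_def .
    qed
    then show "\<forall>\<^sub>F b in at s within {0..}. norm ((laplace f b - laplace f s) / (b - s)
        - - laplace (\<lambda>t. t * f t) s) \<le> \<bar>b - s\<bar> * C"
      by (auto simp: eventually_at_filter intro!: always_eventually)
  qed
qed

lemma laplace_conv:
  assumes "integrable lborel f" "\<And>t. t < 0 \<Longrightarrow> f t = 0"
    and "integrable lborel g" "\<And>t. t < 0 \<Longrightarrow> g t = 0" and "s \<ge> 0"
  shows "laplace (f \<star> g) s = laplace f s * laplace g s"
proof -
  have "(f \<star> g) u * exp (- s * u) = ((\<lambda>t. f t * exp (- s * t)) \<star> (\<lambda>t. g t * exp (- s * t))) u" for u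
  proof -
    have "(f \<star> g) u * exp (- s * u) = (LINT v|lborel. f v * g (u - v) * exp (- s * u))"
      by (simp add: conv_def)
    also have "exp (- s * u) = exp (- s * v) * exp (- s * (u - v))" for v
      by (simp add: algebra_simps flip: exp_add)
    then have "(LINT v|lborel. f v * g (u - v) * exp (- s * u)) =
        ((\<lambda>t. f t * exp (- s * t)) \<star> (\<lambda>t. g t * exp (- s * t))) u"
      unfolding conv_def by (intro Bochner_Integration.integral_cong) (auto simp: mult_ac)
    finally show ?thesis .
  qed
  then have "laplace (f \<star> g) s =
      (LINT u|lborel. ((\<lambda>t. f t * exp (- s * t)) \<star> (\<lambda>t. g t * exp (- s * t))) u)"
    unfolding laplace_def by simp
  also have "\<dots> = laplace f s * laplace g s"
    unfolding laplace_def 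
    by (rule integral_conv(1)[OF integrable_laplace[OF assms(1,2,5)] integrable_laplace[OF assms(3,4,5)]])
  finally show ?thesis .
qed

lemma integrable_square_times_block: "integrable lborel (\<lambda>t. t\<^sup>2 * block t)"
proof (rule integrable_bounded_support)
  note [measurable] = causal_measurable[OF causal_block]
  show "(\<lambda>t. t\<^sup>2 * block t) \<in> borel_measurable borel" by measurable
  show "\<bar>t\<^sup>2 * block t\<bar> \<le> 1" if "t \<in> cbox 0 1" for t
    using that by (auto simp: block_def indicator_def power_le_one)
  show "t\<^sup>2 * block t = 0" if "t \<notin> cbox 0 1" for t
    using that by (auto simp: block_def indicator_def)
qed

lemma laplace_block:
  assumes "s > 0"
  shows "laplace block s = (1 - exp (- s)) / s"
proof -
  note T = has_bochner_integral_exp_tail[OF assms]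
  have "laplace block s =
      (LINT t|lborel. indicator {0..} t * exp (- s * t) - indicator {1..} t * exp (- s * t))"
    unfolding laplace_def by (rule Bochner_Integration.integral_cong) (auto simp: block_def indicator_def)
  also have "\<dots> = exp (- s * 0) / s - exp (- s * 1) / s"
    using has_bochner_integral_diff[OF T T] by (simp add: has_bochner_integral_iff)
  finally show ?thesis by (simp add: diff_divide_distrib)
qed

lemma laplace_block_0: "laplace block 0 = 1"
  by (simp add: laplace_def integral_block)

lemma continuous_on_laplace_block: "continuous_on {0..} (laplace block)"
proof (rule DERIV_continuous_on)
  show "(laplace block has_real_derivative - laplace (\<lambda>t. t * block t) s) (at s within {0..})"
    if "s \<in> {0..}" for s
    by (rule laplace_has_derivative)
      (use that integrable_block integrable_square_times_block causal_neg[OF causal_block] in auto)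
qed

text \<open>
  With \<open>G\<close> and \<open>E\<close> the transforms of \<open>\<rho>\<close> and of the indicator of \<open>[0, 1)\<close>, the equation
  \<open>t \<rho>(t) = (block \<star> \<rho>)(t)\<close> becomes \<open>G' = - E G\<close>. Hence \<open>G(s) exp (\<integral>\<^sub>0\<^sup>s E)\<close> is constant, and its
  value at \<open>s = 0\<close> is the integral of \<open>\<rho>\<close>.
\<close>

lemma laplace_dickman_invariant:
  assumes "s \<ge> 0"
  shows "laplace dickman s * exp (integral {0..s} (laplace block)) = integral\<^sup>L lborel dickman"
proof -
  let ?N = "\<lambda>r. laplace dickman r * exp (integral {0..r} (laplace block))"
  have "(?N has_real_derivative 0) (at r within {0..s})" if r: "r \<in> {0..s}" for r
  proof -
    have "(\<lambda>t. t * dickman t) = block \<star> dickman" by (rule ext) (rule times_id_dickman)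
    then have "laplace (\<lambda>t. t * dickman t) r = laplace block r * laplace dickman r"
      using laplace_conv[OF integrable_block causal_neg[OF causal_block] integrable_dickman dickman_neg, of r] r
      by simp
    moreover have "(laplace dickman has_real_derivative - laplace (\<lambda>t. t * dickman t) r) (at r within {0..s})"
      by (rule has_field_derivative_subset, rule laplace_has_derivative)
        (use r integrable_dickman integrable_square_times_dickman dickman_neg in auto)
    moreover have "((\<lambda>r. integral {0..r} (laplace block)) has_real_derivative laplace block r) (at r within {0..s})"
      by (rule integral_has_real_derivative) (use r in \<open>auto intro: continuous_on_subset[OF continuous_on_laplace_block]\<close>)
    ultimately show ?thesis
      by (auto intro!: derivative_eq_intros)
  qed
  then obtain c where c: "\<And>r. r \<in> {0..s} \<Longrightarrow> ?N r = c"
    using has_field_derivative_zero_constant[of "{0..s}" ?N] by auto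
  have "?N s = ?N 0" using c[of s] c[of 0] assms by simp
  then show ?thesis by (simp add: laplace_def)
qed

text \<open>
  This is where Euler's constant enters. Both quantities are integrals over \<open>[0, n]\<close>: the harmonic
  number of \<open>(1 - (1 - t / n)\<^sup>n) / t\<close>, the other of \<open>(1 - e\<^sup>-\<^sup>t) / t\<close>. The classical estimate
  \<open>0 \<le> e\<^sup>-\<^sup>t - (1 - t / n)\<^sup>n \<le> t\<^sup>2 e\<^sup>-\<^sup>t / n\<close> compares them.
\<close>

lemma harm_minus_integral_laplace_block:
  assumes "n > 0"
  shows "0 \<le> harm n - integral {0..real n} (laplace block)"
    and "harm n - integral {0..real n} (laplace block) \<le> 1 / n"
proof -
  \<comment> \<open>The geometric sum equals \<open>(1 - (1 - t / n)\<^sup>n) / t\<close> but is also meaningful at \<open>t = 0\<close>.\<close>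
  define S where "S t = (\<Sum>k<n. (1 - t / n) ^ k / n)" for t :: real
  have S: "(S has_integral harm n) {0..real n}"
    unfolding S_def harm_altdef
  proof (rule has_integral_sum)
    fix k
    have "((\<lambda>t. (1 - t / n) ^ k / n) has_integral
        - ((1 - real n / n) ^ Suc k) / Suc k - (- ((1 - 0 / n) ^ Suc k) / Suc k)) {0..real n}"
    proof (rule fundamental_theorem_of_calculus)
      fix t :: real
      have "((\<lambda>t. - ((1 - t / n) ^ Suc k) / Suc k) has_real_derivative (1 - t / n) ^ k / n) (at t within {0..real n})"
      proof -
        have "((\<lambda>t. 1 - t / n) has_real_derivative - 1 / n) (at t within {0..real n})"
          using assms by (auto intro!: derivative_eq_intros)
        from DERIV_cmult[OF DERIV_power_Suc[OF this, of k], of "- 1 / Suc k"]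
        have "((\<lambda>t. - 1 / Suc k * (1 - t / n) ^ Suc k) has_real_derivative
            - 1 / Suc k * (Suc k * (- 1 / n * (1 - t / n) ^ k))) (at t within {0..real n})"
          by (simp only: of_nat_Suc)
        moreover have "- 1 / Suc k * (Suc k * (- 1 / n * (1 - t / n) ^ k)) = (1 - t / n) ^ k / n"
          by simp
        ultimately show ?thesis by (simp del: power_Suc of_nat_Suc)
      qed
      then show "((\<lambda>t. - ((1 - t / n) ^ Suc k) / Suc k) has_vector_derivative (1 - t / n) ^ k / n) (at t within {0..real n})"
        by (simp add: has_real_derivative_iff_has_vector_derivative)
    qed auto
    then show "((\<lambda>t. (1 - t / n) ^ k / n) has_integral inverse (real (Suc k))) {0..real n}"
      using assms by (simp add: inverse_eq_divide)
  qed auto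
  have E: "(laplace block has_integral integral {0..real n} (laplace block)) {0..real n}"
    by (intro integrable_integral integrable_continuous_real continuous_on_subset[OF continuous_on_laplace_block]) auto
  have D: "((\<lambda>t. S t - laplace block t) has_integral harm n - integral {0..real n} (laplace block)) {0..real n}"
    by (rule has_integral_diff[OF S E])
  have bound: "0 \<le> S t - laplace block t \<and> S t - laplace block t \<le> t * exp (- t) / n"
    if t: "t \<in> {0..real n}" for t
  proof (cases "t = 0")
    case True
    then show ?thesis using assms by (simp add: S_def laplace_block_0)
  next
    case False
    then have t0: "t > 0" "t \<le> n" using t by auto
    have "(1 - t / n) ^ n = 1 - t * S t"
      using one_diff_power_eq[of "1 - t / n" n] by (simp add: S_def flip: sum_divide_distrib)
    then have S_t: "S t = (1 - (1 - t / n) ^ n) / t" using t0 by (simp add: field_simps)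
    have d: "S t - laplace block t = (exp (- t) - (1 - t / n) ^ n) / t"
      using t0 by (simp add: S_t laplace_block diff_divide_distrib)
    have e: "exp (- t) = exp (- t / n) ^ n" using assms by (simp flip: exp_of_nat_mult)
    have "(1 - t / n) ^ n \<le> exp (- t)"
      unfolding e using exp_ge_add_one_self[of "- t / n"] t0 assms
      by (intro power_mono) (auto simp: field_simps)
    moreover have "exp (- t) - (1 - t / n) ^ n \<le> t\<^sup>2 * exp (- t) / n"
    proof -
      \<comment> \<open>Bernoulli's inequality for \<open>1 - (t / n)\<^sup>2 = (1 - t / n) (1 + t / n)\<close>\<close>
      have "1 + real n * (- (t / n)\<^sup>2) \<le> (1 + - (t / n)\<^sup>2) ^ n"
        using t0 assms by (intro Bernoulli_inequality) (auto simp: power_le_one)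
      also have "1 + - (t / n)\<^sup>2 = (1 - t / n) * (1 + t / n)"
        by (simp add: algebra_simps power2_eq_square)
      also have "\<dots> ^ n \<le> ((1 - t / n) * exp (t / n)) ^ n"
        using t0 assms exp_ge_add_one_self[of "t / n"]
        by (intro power_mono mult_left_mono mult_nonneg_nonneg) (auto simp: field_simps)
      also have "\<dots> = (1 - t / n) ^ n * exp t"
        using assms by (simp add: power_mult_distrib flip: exp_of_nat_mult)
      finally have "(1 - t\<^sup>2 / n) * exp (- t) \<le> (1 - t / n) ^ n * exp t * exp (- t)"
        using assms by (intro mult_right_mono) (auto simp: power2_eq_square)
      also have "\<dots> = (1 - t / n) ^ n" by (simp add: mult.assoc flip: exp_add)
      finally show ?thesis by (simp add: algebra_simps)
    qed
    ultimately show ?thesis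
      using t0 assms by (auto simp: d field_simps power2_eq_square)
  qed
  show "0 \<le> harm n - integral {0..real n} (laplace block)"
    by (rule has_integral_nonneg[OF D]) (use bound in auto)
  have M: "((\<lambda>t. t * exp (- t) / n) has_integral
      - (real n + 1) * exp (- real n) / n - (- (0 + 1) * exp (- 0) / n)) {0..real n}"
  proof (rule fundamental_theorem_of_calculus)
    fix t :: real
    have "((\<lambda>t. - (t + 1) * exp (- t) / n) has_real_derivative t * exp (- t) / n) (at t within {0..real n})"
      using assms by (auto intro!: derivative_eq_intros simp: field_simps)
    then show "((\<lambda>t. - (t + 1) * exp (- t) / n) has_vector_derivative t * exp (- t) / n) (at t within {0..real n})"
      by (simp add: has_real_derivative_iff_has_vector_derivative)
  qed auto
  have "harm n - integral {0..real n} (laplace block)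
      \<le> - (real n + 1) * exp (- real n) / n - (- (0 + 1) * exp (- 0) / n)"
    by (rule has_integral_le[OF D M]) (use bound in auto)
  also have "\<dots> \<le> 1 / n" using assms by (simp add: field_simps)
  finally show "harm n - integral {0..real n} (laplace block) \<le> 1 / n" .
qed

text \<open>
  Since \<open>\<rho>\<close> lies between the indicators of \<open>[0, 1)\<close> and \<open>[0, \<infinity>)\<close>, its transform is \<open>1 / s\<close> up to a
  relative error \<open>e\<^sup>-\<^sup>s\<close>; this normalises the solution of the differential equation.
\<close>

lemma laplace_dickman_bounds:
  assumes "s > 0"
  shows "1 - exp (- s) \<le> s * laplace dickman s" "s * laplace dickman s \<le> 1"
proof -
  have i: "integrable lborel (\<lambda>t. dickman t * exp (- s * t))"
    using assms dickman_neg integrable_dickman by (intro integrable_laplace) auto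
  have "laplace block s \<le> laplace dickman s"
    unfolding laplace_def
  proof (rule integral_mono[OF _ i])
    show "integrable lborel (\<lambda>t. block t * exp (- s * t))"
      using assms causal_neg[OF causal_block] integrable_block by (intro integrable_laplace) auto
    show "block t * exp (- s * t) \<le> dickman t * exp (- s * t)" for t
      using dickman_nonneg[of t] by (auto simp: block_def indicator_def dickman_unit)
  qed
  then show "1 - exp (- s) \<le> s * laplace dickman s"
    using assms by (simp add: laplace_block field_simps)
  note T = has_bochner_integral_exp_tail[OF assms, of 0]
  have "laplace dickman s \<le> (LINT t|lborel. indicator {0..} t * exp (- s * t))"
    unfolding laplace_def
  proof (rule integral_mono[OF i])
    show "integrable lborel (\<lambda>t. indicator {0..} t * exp (- s * t))"
      using T by (simp add: has_bochner_integral_iff)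
    show "dickman t * exp (- s * t) \<le> indicator {0..} t * exp (- s * t)" for t
      using dickman_le_1[of t] by (auto simp: indicator_def dickman_neg)
  qed
  also have "\<dots> = 1 / s" using T by (simp add: has_bochner_integral_iff)
  finally show "s * laplace dickman s \<le> 1" using assms by (simp add: field_simps)
qed

text \<open>
  Evaluate the invariant \<open>G(s) exp (\<integral>\<^sub>0\<^sup>s E)\<close> at \<open>s = n\<close> and let \<open>n \<rightarrow> \<infinity>\<close>: here \<open>n G(n) \<rightarrow> 1\<close>, while
  \<open>\<integral>\<^sub>0\<^sup>n E - ln n\<close> has the same limit as \<open>harm n - ln n\<close>.
\<close>

theorem integral_dickman: "integral\<^sup>L lborel dickman = exp euler_mascheroni"
proof (rule LIMSEQ_unique)
  define A where "A n = real n * laplace dickman (real n)" for n :: nat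
  define B where "B n = harm n - integral {0..real n} (laplace block)" for n :: nat
  have A: "A \<longlonglongrightarrow> 1"
  proof (rule tendsto_sandwich)
    have "(\<lambda>n. 1 - exp (- real n)) \<longlonglongrightarrow> 1 - 0"
      by (intro tendsto_intros filterlim_compose[OF exp_at_bot]
          filterlim_compose[OF filterlim_uminus_at_bot_at_top] filterlim_real_sequentially)
    then show "(\<lambda>n. 1 - exp (- real n)) \<longlonglongrightarrow> 1" by simp
    show "\<forall>\<^sub>F n in sequentially. 1 - exp (- real n) \<le> A n"
      using eventually_gt_at_top[of 0] by eventually_elim (auto simp: A_def laplace_dickman_bounds)
    show "\<forall>\<^sub>F n in sequentially. A n \<le> 1"
      using eventually_gt_at_top[of 0] by eventually_elim (auto simp: A_def laplace_dickman_bounds)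
  qed auto
  have B: "B \<longlonglongrightarrow> 0"
  proof (rule tendsto_sandwich)
    show "\<forall>\<^sub>F n in sequentially. 0 \<le> B n" "\<forall>\<^sub>F n in sequentially. B n \<le> 1 / real n"
      using eventually_gt_at_top[of 0]
      by (eventually_elim, use harm_minus_integral_laplace_block in \<open>auto simp: B_def\<close>)+
  qed (auto intro: lim_1_over_n)
  have "(\<lambda>n. A n * exp (harm n - ln (real n)) * exp (- B n)) \<longlonglongrightarrow> 1 * exp euler_mascheroni * exp (- 0)"
    by (intro tendsto_intros A B euler_mascheroni_LIMSEQ)
  moreover have "\<forall>\<^sub>F n in sequentially.
      A n * exp (harm n - ln (real n)) * exp (- B n) = integral\<^sup>L lborel dickman"
    using eventually_gt_at_top[of 0]
  proof eventually_elim
    case (elim n)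
    have "exp (harm n - ln (real n)) * exp (- B n) = exp (integral {0..real n} (laplace block) - ln (real n))"
      by (simp add: B_def flip: exp_add)
    also have "\<dots> = exp (integral {0..real n} (laplace block)) / real n"
      using elim by (simp add: exp_diff)
    finally have "exp (harm n - ln (real n)) * exp (- B n) = exp (integral {0..real n} (laplace block)) / real n" .
    then show ?case
      using laplace_dickman_invariant[of "real n"] elim unfolding A_def by (simp add: mult.assoc)
  qed
  ultimately show "(\<lambda>n::nat. integral\<^sup>L lborel dickman) \<longlonglongrightarrow> exp euler_mascheroni"
    using Lim_transform_eventually by fastforce
qed auto

section \<open>Smooth and rough numbers\<close>

text \<open>
  Adjoining a prime \<open>p\<close> to \<open>P\<close>, the new set of integers is the disjoint union of the old one and of
  \<open>p\<close> times itself. As the sums converge, the new sum \<open>s'\<close> and the old one \<open>s\<close> satisfy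
  \<open>s' = s + s' / p\<close>.
\<close>
lemma infsum_inverse_euler_product:
  assumes "finite P" "\<And>p. p \<in> P \<Longrightarrow> prime p"
  shows "(\<Sum>\<^sub>\<infinity>n\<in>{n::nat. n > 0 \<and> (\<forall>p. prime p \<and> p dvd n \<longrightarrow> p \<in> P)}. 1 / real n)
    * (\<Prod>p\<in>P. 1 - 1 / real p) = 1"
  using assms
proof (induction P rule: finite_induct)
  case empty
  have "{n::nat. n > 0 \<and> (\<forall>p. prime p \<and> p dvd n \<longrightarrow> p \<in> {})} = {1}"
    using prime_factor_nat by auto
  then show ?case by simp
next
  case (insert p P)
  define S where "S P = {n::nat. n > 0 \<and> (\<forall>q. prime q \<and> q dvd n \<longrightarrow> q \<in> P)}" for P
  have p: "prime p" "p \<notin> P" using insert by auto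
  have p0: "p > 0" using p prime_gt_0_nat by blast
  have summ: "(\<lambda>n. 1 / real n) summable_on S (insert p P)"
    unfolding S_def using insert by (intro summable_on_inverse_prime_factors) auto
  have split: "S (insert p P) = S P \<union> (*) p ` S (insert p P)"
  proof (intro equalityI subsetI)
    fix n assume n: "n \<in> S (insert p P)"
    show "n \<in> S P \<union> (*) p ` S (insert p P)"
    proof (cases "p dvd n")
      case True
      then obtain m where m: "n = p * m" by blast
      then have "m \<in> S (insert p P)" using n by (auto simp: S_def)
      then show ?thesis using m by blast
    qed (use n in \<open>auto simp: S_def\<close>)
  next
    fix n assume "n \<in> S P \<union> (*) p ` S (insert p P)"
    then show "n \<in> S (insert p P)"
      using p p0 by (auto simp: S_def prime_dvd_mult_iff dest: primes_dvd_imp_eq)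
  qed
  have disj: "S P \<inter> (*) p ` S (insert p P) = {}"
    using p by (auto simp: S_def)
  have sub: "(\<lambda>n. 1 / real n) summable_on S P" "(\<lambda>n. 1 / real n) summable_on (*) p ` S (insert p P)"
    using summable_on_subset_banach[OF summ] split by blast+
  have inj: "inj_on ((*) p) (S (insert p P))" using p0 by (auto simp: inj_on_def)
  let ?\<sigma> = "\<lambda>P. \<Sum>\<^sub>\<infinity>n\<in>S P. 1 / real n"
  have "?\<sigma> (insert p P) = ?\<sigma> P + (\<Sum>\<^sub>\<infinity>n\<in>(*) p ` S (insert p P). 1 / real n)"
    by (subst split) (rule infsum_Un_disjoint[OF sub disj])
  also have "(\<Sum>\<^sub>\<infinity>n\<in>(*) p ` S (insert p P). 1 / real n) = (\<Sum>\<^sub>\<infinity>n\<in>S (insert p P). 1 / real p * (1 / real n))"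
    by (subst infsum_reindex[OF inj]) (simp add: o_def)
  also have "\<dots> = 1 / real p * ?\<sigma> (insert p P)" by (rule infsum_cmult_right')
  finally have "?\<sigma> (insert p P) * (1 - 1 / real p) = ?\<sigma> P" by (simp add: algebra_simps)
  moreover have "?\<sigma> P * (\<Prod>p\<in>P. 1 - 1 / real p) = 1"
    using insert unfolding S_def by blast
  ultimately have "?\<sigma> (insert p P) * (1 - 1 / real p) * (\<Prod>p\<in>P. 1 - 1 / real p) = 1" by simp
  then show ?case using insert.hyps by (simp add: S_def mult.assoc)
qed

lemma finite_primes_le: "finite {p::nat. prime p \<and> real p \<le> y}"
  by (rule finite_subset[of _ "{..nat \<lceil>y\<rceil>}"]) (auto, linarith)

lemma infsum_inverse_smooth: "(\<Sum>\<^sub>\<infinity>n\<in>smooth y. 1 / real n) * Pi_prod y = 1"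
proof -
  have "smooth y = {n. n > 0 \<and> (\<forall>p. prime p \<and> p dvd n \<longrightarrow> p \<in> {p. prime p \<and> real p \<le> y})}"
    by (auto simp: smooth_def)
  then show ?thesis
    unfolding Pi_prod_def using infsum_inverse_euler_product[OF finite_primes_le, of y] by simp
qed

definition rough :: "real \<Rightarrow> nat set" where
  "rough y = {n. n > 0 \<and> (\<forall>p. prime p \<and> p dvd n \<longrightarrow> real p > y)}"

lemma smooth_rough_decomposition:
  assumes "m > 0"
  shows "\<exists>n\<in>smooth y. \<exists>k\<in>rough y. m = n * k"
  using assms
proof (induction m rule: prime_divisors_induct)
  case (unit m)
  have "1 \<in> smooth y" "1 \<in> rough y" by (auto simp: smooth_def rough_def)
  then show ?case using unit by force
next
  case (factor p m)
  then obtain n k where nk: "n \<in> smooth y" "k \<in> rough y" "m = n * k" by auto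
  have p: "p > 0" "\<And>q l. prime q \<Longrightarrow> q dvd p * l \<Longrightarrow> q = p \<or> q dvd l"
    using factor prime_gt_0_nat primes_dvd_imp_eq by (auto simp: prime_dvd_mult_iff)
  show ?case
  proof (cases "real p \<le> y")
    case True
    have "real q \<le> y" if "prime q" "q dvd p * n" for q
      using p(2)[OF that] nk(1) True that(1) by (auto simp: smooth_def)
    then have "p * n \<in> smooth y" using nk(1) p(1) by (auto simp: smooth_def)
    then show ?thesis using nk by (metis mult.assoc)
  next
    case False
    have "real q > y" if "prime q" "q dvd p * k" for q
      using p(2)[OF that] nk(2) False that(1) by (auto simp: rough_def)
    then have "p * k \<in> rough y" using nk(2) p(1) by (auto simp: rough_def)
    then show ?thesis using nk by (metis mult.left_commute)
  qed
qed simp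

text \<open>
  Applied in both directions, this gives uniqueness of the factorisation into a smooth and a rough
  number.
\<close>

lemma smooth_dvd_if_mult_rough:
  assumes "n \<in> smooth y" "k' \<in> rough y" "n * k = n' * k'"
  shows "n dvd n'"
proof -
  have "coprime n k'"
  proof (rule ccontr)
    assume "\<not> coprime n k'"
    then have "gcd n k' \<noteq> 1" by (simp add: coprime_iff_gcd_eq_1)
    then obtain p where p: "prime p" "p dvd gcd n k'" using prime_factor_nat by blast
    then have "p dvd n" "p dvd k'" by simp_all
    then have "real p \<le> y" "y < real p" using assms(1,2) p(1) by (auto simp: smooth_def rough_def)
    then show False by simp
  qed
  moreover have "n dvd n' * k'" using assms(3) by (metis dvd_triv_left)
  ultimately show ?thesis by (simp add: coprime_dvd_mult_left_iff)
qed

lemma finite_nat_le_real: "finite {n \<in> A. real n \<le> x}"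
  by (rule finite_subset[of _ "{..nat \<lceil>x\<rceil>}"]) (auto, linarith)

text \<open>
  The left-hand side counts pairs of a smooth \<open>n\<close> and a rough \<open>k\<close> with \<open>n k \<le> x\<close>, and multiplication
  maps these bijectively onto the positive integers up to \<open>x\<close>.
\<close>

lemma sum_Phi_smooth:
  assumes "x > 0"
  shows "(\<Sum>n\<in>{n \<in> smooth y. real n \<le> x}. Phi (x / real n) y) = nat \<lfloor>x\<rfloor>"
proof -
  let ?A = "{n \<in> smooth y. real n \<le> x}"
  let ?B = "\<lambda>n. {k \<in> rough y. real k \<le> x / real n}"
  have Phi: "Phi (x / real n) y = card (?B n)" for n
    unfolding Phi_def by (rule arg_cong[of _ _ card]) (auto simp: rough_def)
  have pos: "n > 0" if "n \<in> smooth y" for n using that by (simp add: smooth_def)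
  have posr: "n > 0" if "n \<in> rough y" for n using that by (simp add: rough_def)
  have "(\<Sum>n\<in>?A. Phi (x / real n) y) = card (Sigma ?A ?B)"
    unfolding Phi by (rule card_SigmaI[symmetric]) (use finite_nat_le_real in auto)
  also have "bij_betw (\<lambda>(n, k). n * k) (Sigma ?A ?B) {1..nat \<lfloor>x\<rfloor>}"
    unfolding bij_betw_def
  proof (intro conjI inj_onI equalityI subsetI)
    fix a b assume ab: "a \<in> Sigma ?A ?B" "b \<in> Sigma ?A ?B"
      "(case a of (n, k) \<Rightarrow> n * k) = (case b of (n, k) \<Rightarrow> n * k)"
    obtain n k n' k' where e: "a = (n, k)" "b = (n', k')" by (cases a; cases b) auto
    have "n dvd n'" "n' dvd n"
      using ab e smooth_dvd_if_mult_rough[of n y k' k n'] smooth_dvd_if_mult_rough[of n' y k k' n] by auto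
    then have "n = n'" by (rule dvd_antisym)
    then show "a = b" using ab e pos by auto
  next
    fix m assume "m \<in> (\<lambda>(n, k). n * k) ` Sigma ?A ?B"
    then obtain n k where nk: "m = n * k" "n \<in> smooth y" "k \<in> rough y" "real k \<le> x / real n" by auto
    have "real m \<le> x" using nk pos[of n] by (simp add: field_simps)
    then have "m \<le> nat \<lfloor>x\<rfloor>" by linarith
    moreover have "m \<ge> 1" using nk pos[of n] posr[of k] by simp
    ultimately show "m \<in> {1..nat \<lfloor>x\<rfloor>}" by simp
  next
    fix m assume m: "m \<in> {1..nat \<lfloor>x\<rfloor>}"
    then obtain n k where nk: "n \<in> smooth y" "k \<in> rough y" "m = n * k"
      using smooth_rough_decomposition[of m y] by auto
    have mx: "real m \<le> x" using m assms by (auto simp: le_nat_iff le_floor_iff)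
    have "real n \<le> real m" using nk posr[of k] by (simp del: of_nat_mult)
    moreover have "real k \<le> x / real n" using nk mx pos[of n] by (simp add: field_simps)
    ultimately show "m \<in> (\<lambda>(n, k). n * k) ` Sigma ?A ?B" using nk mx by force
  qed
  then have "card (Sigma ?A ?B) = nat \<lfloor>x\<rfloor>" by (simp add: bij_betw_same_card)
  finally show ?thesis .
qed

section \<open>Rescaled counting functions\<close>

definition smooth_density :: "real \<Rightarrow> real \<Rightarrow> real" where
  "smooth_density y v = real (Psi (y powr v) y) / y powr v"

definition floor_density :: "real \<Rightarrow> real \<Rightarrow> real" where
  "floor_density y v = real_of_int \<lfloor>y powr v\<rfloor> / y powr v"

lemma Psi_le: "x \<ge> 0 \<Longrightarrow> real (Psi x y) \<le> x"
proof -
  assume x: "x \<ge> 0"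
  have "Psi x y \<le> card {1..nat \<lfloor>x\<rfloor>}"
    unfolding Psi_def by (rule card_mono) (auto simp: smooth_def le_nat_iff le_floor_iff)
  then show ?thesis using x by (simp add: le_nat_iff le_floor_iff)
qed

lemma causal_bounded_powr_density:
  assumes "y > 1" "f \<in> borel_measurable borel" "\<And>v. 0 \<le> f v" "\<And>v. f v \<le> y powr v" "\<And>v. v < 0 \<Longrightarrow> f v = 0"
  shows "causal (\<lambda>v. f v / y powr v)"
proof -
  have "\<bar>f v / y powr v\<bar> \<le> 1" for v using assms by (simp add: divide_le_eq)
  then have "\<exists>B. \<forall>v\<le>u. \<bar>f v / y powr v\<bar> \<le> B" for u by blast
  moreover have "(\<lambda>v. f v / y powr v) \<in> borel_measurable borel" using assms(2) by measurable
  ultimately show ?thesis using assms(5) by (simp add: causal_def)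
qed

lemma powr_less_1: "y > 1 \<Longrightarrow> v < 0 \<Longrightarrow> y powr v < (1::real)"
  using powr_less_mono[of v 0 y] by simp

lemma causal_smooth_density:
  assumes "y > 1"
  shows "causal (smooth_density y)"
  unfolding smooth_density_def
proof (rule causal_bounded_powr_density[OF assms])
  have "mono (\<lambda>v. real (Psi (y powr v) y))"
  proof (rule monoI)
    fix v w :: real assume "v \<le> w"
    then have "y powr v \<le> y powr w" using assms by (intro powr_mono) auto
    then show "real (Psi (y powr v) y) \<le> real (Psi (y powr w) y)"
      unfolding Psi_def of_nat_le_iff by (intro card_mono finite_nat_le_real) auto
  qed
  then show "(\<lambda>v. real (Psi (y powr v) y)) \<in> borel_measurable borel" by (rule borel_measurable_mono)
  show "real (Psi (y powr v) y) = 0" if "v < 0" for v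
  proof -
    have "{n \<in> smooth y. real n \<le> y powr v} = {}"
      using powr_less_1[OF assms that] by (force simp: smooth_def)
    then show ?thesis unfolding Psi_def by (simp only: card.empty)
  qed
qed (auto intro: Psi_le)

lemma causal_floor_density:
  assumes "y > 1"
  shows "causal (floor_density y)"
  unfolding floor_density_def
proof (rule causal_bounded_powr_density[OF assms])
  show "real_of_int \<lfloor>y powr v\<rfloor> = 0" if "v < 0" for v
    using powr_less_1[OF assms that] by (simp add: floor_eq_iff)
qed (auto, measurable)

definition exp_tail :: "real \<Rightarrow> real \<Rightarrow> real" where
  "exp_tail y v = heaviside v * y powr (- v)"

lemma causal_exp_tail:
  assumes "y > 1"
  shows "causal (exp_tail y)"
proof -
  have "exp_tail y = (\<lambda>v. heaviside v / y powr v)"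
    by (simp add: exp_tail_def fun_eq_iff powr_minus_divide)
  moreover have "causal (\<lambda>v. heaviside v / y powr v)"
    using assms by (intro causal_bounded_powr_density) (auto simp: heaviside_def indicator_def ge_one_powr_ge_zero)
  ultimately show ?thesis by simp
qed

lemma mu_eq_conv:
  assumes "y > 1"
  shows "mu y u = (buchstab \<star> exp_tail y) u"
proof -
  have "mu y u = (LBINT v:{0..u}. exp_tail y v * buchstab (u - v))"
    unfolding mu_def by (intro set_lebesgue_integral_cong) (auto simp: exp_tail_def heaviside_def)
  also have "\<dots> = (exp_tail y \<star> buchstab) u"
    by (intro set_integral_conv causal_exp_tail assms causal_buchstab)
  finally show ?thesis by (simp add: conv_commute)
qed

lemma powr_log_cancel_ln: "y > 1 \<Longrightarrow> x > 0 \<Longrightarrow> y powr (ln x / ln y) = (x::real)"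
  by (simp add: powr_def)

text \<open>
  A smooth \<open>n\<close> contributes \<open>1\<close> to \<open>\<Psi>\<close> from \<open>s = log n / log y\<close> on; after division by \<open>y\<^sup>s\<close> this step is a
  translate of the decaying exponential, weighted by \<open>1 / n\<close>.
\<close>

lemma sum_exp_tail_smooth:
  assumes y: "y > 1" and "y powr s \<le> x"
  shows "(\<Sum>n\<in>{n \<in> smooth y. real n \<le> x}. exp_tail y (s - ln (real n) / ln y) / real n) = smooth_density y s"
proof -
  let ?A = "{n \<in> smooth y. real n \<le> x}"
  have "exp_tail y (s - ln (real n) / ln y) / real n = of_bool (real n \<le> y powr s) / y powr s"
    if n: "n \<in> ?A" for n
  proof -
    have n0: "real n > 0" using n by (simp add: smooth_def)
    have "s - ln (real n) / ln y \<ge> 0 \<longleftrightarrow> real n \<le> y powr s"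
      using log_le_iff[OF y n0, of s] by (simp add: log_def)
    then have "heaviside (s - ln (real n) / ln y) = of_bool (real n \<le> y powr s)"
      by (simp add: heaviside_def indicator_def)
    moreover have "y powr (- (s - ln (real n) / ln y)) = real n / y powr s"
      using powr_log_cancel_ln[OF y n0] by (simp add: powr_diff)
    ultimately show ?thesis using n0 by (simp add: exp_tail_def)
  qed
  then have "(\<Sum>n\<in>?A. exp_tail y (s - ln (real n) / ln y) / real n) =
      (\<Sum>n\<in>?A. of_bool (real n \<le> y powr s) / y powr s)" by (rule sum.cong[OF refl])
  also have "\<dots> = real (card (?A \<inter> {n. real n \<le> y powr s})) / y powr s"
    using finite_nat_le_real[of "smooth y" x] by (simp add: flip: sum_divide_distrib)
  also have "?A \<inter> {n. real n \<le> y powr s} = {n \<in> smooth y. real n \<le> y powr s}"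
    using assms by auto
  finally show ?thesis by (simp add: smooth_density_def Psi_def)
qed

text \<open>
  \<open>\<mu>\<close> is \<open>\<omega>\<close> convolved with the decaying exponential, whose weighted translates over smooth \<open>n\<close> add up
  to the density of smooth numbers.
\<close>

lemma sum_mu_smooth:
  assumes y: "y > 1" and x: "x > 0"
  shows "(\<Sum>n\<in>{n \<in> smooth y. real n \<le> x}. x / real n * mu y (ln (x / real n) / ln y)) =
    x * (buchstab \<star> smooth_density y) (ln x / ln y)"
proof -
  let ?A = "{n \<in> smooth y. real n \<le> x}"
  define u where "u = ln x / ln y"
  note c = causal_buchstab causal_exp_tail[OF y]
  have "(\<Sum>n\<in>?A. x / real n * mu y (ln (x / real n) / ln y)) =
      (\<Sum>n\<in>?A. (LINT v|lborel. x / real n * (buchstab v * exp_tail y (u - ln (real n) / ln y - v))))"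
  proof (rule sum.cong[OF refl])
    fix n assume n: "n \<in> ?A"
    then have "ln (x / real n) / ln y = u - ln (real n) / ln y"
      using x by (simp add: u_def smooth_def ln_div diff_divide_distrib)
    then show "x / real n * mu y (ln (x / real n) / ln y) =
        (LINT v|lborel. x / real n * (buchstab v * exp_tail y (u - ln (real n) / ln y - v)))"
      by (simp add: mu_eq_conv[OF y] conv_def)
  qed
  also have "\<dots> = (LINT v|lborel. (\<Sum>n\<in>?A. x / real n * (buchstab v * exp_tail y (u - ln (real n) / ln y - v))))"
    by (rule Bochner_Integration.integral_sum[symmetric]) (intro integrable_mult_right integrable_conv c)
  also have "\<dots> = (LINT v|lborel. x * (buchstab v * smooth_density y (u - v)))"
  proof (rule Bochner_Integration.integral_cong[OF refl])
    fix v
    have "(\<Sum>n\<in>?A. x / real n * (buchstab v * exp_tail y (u - ln (real n) / ln y - v))) =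
        x * buchstab v * (\<Sum>n\<in>?A. exp_tail y (u - v - ln (real n) / ln y) / real n)"
      unfolding sum_distrib_left by (rule sum.cong) (auto simp: algebra_simps)
    also have "\<dots> = x * (buchstab v * smooth_density y (u - v))"
    proof (cases "v < 0")
      case False
      then have "y powr (u - v) \<le> y powr u" using y by (intro powr_mono) auto
      also have "\<dots> = x" unfolding u_def by (rule powr_log_cancel_ln[OF y x])
      finally show ?thesis using sum_exp_tail_smooth[OF y] by simp
    qed (simp add: buchstab_below)
    finally show "(\<Sum>n\<in>?A. x / real n * (buchstab v * exp_tail y (u - ln (real n) / ln y - v))) =
      x * (buchstab v * smooth_density y (u - v))" .
  qed
  finally show ?thesis by (simp add: conv_def u_def)
qed

lemma R_star_eq:
  assumes y: "y \<ge> 2" and x: "x > 0"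
  shows "R_star x y = real (Psi x y) - \<lfloor>x\<rfloor> + x * (buchstab \<star> smooth_density y) (ln x / ln y)"
proof -
  let ?A = "{n \<in> smooth y. real n \<le> x}"
  have n0: "real n > 0" if "n \<in> smooth y" for n using that by (simp add: smooth_def)
  have "R_star x y = (\<Sum>\<^sub>\<infinity>n\<in>?A. Q_star (x / real n) y)"
    unfolding R_star_def
  proof (rule infsum_cong_neutral)
    fix n assume n: "n \<in> smooth y - ?A"
    then have "0 < x / real n" "x / real n < 1" using n0[of n] x by auto
    then show "Q_star (x / real n) y = 0"
      using Phi_mu_eq_0[of "x / real n" y] y by (simp add: Q_star_def V_star_def Let_def)
  qed auto
  also have "\<dots> = (\<Sum>n\<in>?A. Q_star (x / real n) y)"
    using finite_nat_le_real by (rule infsum_finite)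
  also have "\<dots> = (\<Sum>n\<in>?A. 1 + x / real n * mu y (ln (x / real n) / ln y) - real (Phi (x / real n) y))"
    by (rule sum.cong) (use n0 in \<open>auto simp: Q_star_def V_star_def Let_def\<close>)
  also have "\<dots> = real (Psi x y) + x * (buchstab \<star> smooth_density y) (ln x / ln y) - real (nat \<lfloor>x\<rfloor>)"
    using sum_mu_smooth[of y x] sum_Phi_smooth[OF x, of y] y x
    by (simp add: sum.distrib sum_subtractf Psi_def flip: of_nat_sum)
  finally show ?thesis using x by simp
qed

section \<open>Rescaled error terms and their inversion\<close>

definition R_star_density :: "real \<Rightarrow> real \<Rightarrow> real" where
  "R_star_density y v = R_star (y powr v) y / y powr v"

lemma R_star_density_eq:
  assumes "y \<ge> 2"
  shows "R_star_density y v = smooth_density y v - floor_density y v + (buchstab \<star> smooth_density y) v"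
proof -
  have "ln (y powr v) / ln y = v" using assms by (simp add: ln_powr)
  then show ?thesis
    using assms R_star_eq[OF assms, of "y powr v"]
    by (simp add: R_star_density_def smooth_density_def floor_density_def add_divide_distrib diff_divide_distrib)
qed

definition Delta_density :: "real \<Rightarrow> real \<Rightarrow> real" where
  "Delta_density y v = smooth_density y v - floor_density y v - (dickman_deriv \<star> floor_density y) v"

text \<open>
  In the definition of \<open>\<Lambda>\<close> the fractional part contributes \<open>heaviside - floor_density\<close>; since the
  convolution of the Heaviside function with \<open>\<rho>'\<close> is \<open>\<rho> - 1\<close> on the half-line, the terms in \<open>\<rho>\<close>
  cancel.
\<close>

lemma Delta_density_eq:
  assumes y: "y \<ge> 2" and v: "v \<ge> 0"
  shows "Delta (y powr v) y / y powr v = Delta_density y v"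
proof -
  have c: "causal (floor_density y)" using y by (intro causal_floor_density) auto
  have y0: "y powr v > 0" using y by simp
  have frac: "frac (y powr w) / y powr w = 1 - floor_density y w" for w
    using y by (simp add: frac_def floor_density_def diff_divide_distrib)
  have "(LBINT w:{0..v}. dickman_deriv (v - w) * (frac (y powr w) / y powr w)) =
      (LBINT w:{0..v}. (heaviside w - floor_density y w) * dickman_deriv (v - w))"
    unfolding frac by (intro set_lebesgue_integral_cong) (auto simp: heaviside_def)
  also have "\<dots> = ((\<lambda>w. heaviside w - floor_density y w) \<star> dickman_deriv) v"
    by (intro set_integral_conv causal_diff c causal_heaviside causal_dickman_deriv)
  also have "\<dots> = dickman v - 1 - (dickman_deriv \<star> floor_density y) v"
  proof -
    have "heaviside v = 1" using v by (simp add: heaviside_def)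
    then show ?thesis
      using dickman_eq_heaviside_conv[of v] conv_diff_left[OF causal_heaviside c causal_dickman_deriv, of v]
      by (simp add: conv_commute[of dickman_deriv])
  qed
  finally have I: "(LBINT w:{0..v}. dickman_deriv (v - w) * (frac (y powr w) / y powr w)) =
      dickman v - 1 - (dickman_deriv \<star> floor_density y) v" .
  have u: "ln (y powr v) / ln y = v" using y by (simp add: ln_powr)
  have "Lambda (y powr v) y = y powr v * dickman v - frac (y powr v)
      - y powr v * (dickman v - 1 - (dickman_deriv \<star> floor_density y) v)"
    unfolding Lambda_def Let_def u I ..
  then have "Lambda (y powr v) y / y powr v = dickman v - frac (y powr v) / y powr v
      - (dickman v - 1 - (dickman_deriv \<star> floor_density y) v)"
    using y0 by (simp add: diff_divide_distrib)
  then show ?thesis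
    by (simp add: Delta_def Delta_density_def diff_divide_distrib frac smooth_density_def)
qed

lemma causal_R_star_density:
  assumes "y \<ge> 2"
  shows "causal (R_star_density y)"
proof -
  have "R_star_density y = (\<lambda>v. smooth_density y v - floor_density y v + (buchstab \<star> smooth_density y) v)"
    using R_star_density_eq[OF assms] by (rule ext)
  then show ?thesis
    using assms by (auto intro!: causal_add causal_diff causal_conv causal_smooth_density causal_floor_density)
qed

lemma causal_Delta_density:
  assumes "y \<ge> 2"
  shows "causal (Delta_density y)"
proof -
  have "Delta_density y = (\<lambda>v. smooth_density y v - floor_density y v - (dickman_deriv \<star> floor_density y) v)"
    by (rule ext) (rule Delta_density_def)
  then show ?thesis
    using assms by (auto intro!: causal_diff causal_conv causal_smooth_density causal_floor_density)
qed

text \<open>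
  Both inversions reduce to convolving the identity \<open>\<omega> + \<rho>' + \<omega> \<star> \<rho>' = 0\<close> with a density: that of
  smooth numbers in one direction, that of all integers in the other.
\<close>

lemma Delta_density_eq_R_star_density:
  assumes "y \<ge> 2"
  shows "Delta_density y u = R_star_density y u + (R_star_density y \<star> dickman_deriv) u"
proof -
  let ?s = "smooth_density y" and ?f = "floor_density y" and ?r = dickman_deriv and ?w = buchstab
  have c: "causal ?s" "causal ?f" "causal ?r" "causal ?w"
    using assms by (auto intro: causal_smooth_density causal_floor_density)
  have R: "R_star_density y = (\<lambda>v. ?s v - ?f v + (?w \<star> ?s) v)"
    using R_star_density_eq[OF assms] by (rule ext)
  have key: "((\<lambda>t. (?w t + ?r t) + (?w \<star> ?r) t) \<star> ?s) u = 0"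
    unfolding buchstab_conv_dickman_deriv by (simp add: conv_def)
  have "((\<lambda>t. (?w t + ?r t) + (?w \<star> ?r) t) \<star> ?s) u = (?w \<star> ?s) u + (?r \<star> ?s) u + (?w \<star> ?r \<star> ?s) u"
    using c by (simp add: conv_add_left causal_add causal_conv)
  moreover have "(R_star_density y \<star> ?r) u = (?s \<star> ?r) u - (?f \<star> ?r) u + (?w \<star> ?s \<star> ?r) u"
    unfolding R using c by (simp add: conv_add_left conv_diff_left causal_add causal_diff causal_conv)
  moreover have "?w \<star> ?s \<star> ?r = ?w \<star> ?r \<star> ?s"
    using c by (metis conv_assoc conv_commute)
  ultimately show ?thesis
    using key unfolding R_star_density_eq[OF assms] Delta_density_def conv_commute[of ?s ?r] conv_commute[of ?f ?r]
    by simp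
qed

lemma R_star_density_eq_Delta_density:
  assumes "y \<ge> 2"
  shows "R_star_density y u = Delta_density y u + (Delta_density y \<star> buchstab) u"
proof -
  let ?s = "smooth_density y" and ?f = "floor_density y" and ?r = dickman_deriv and ?w = buchstab
  have c: "causal ?s" "causal ?f" "causal ?r" "causal ?w"
    using assms by (auto intro: causal_smooth_density causal_floor_density)
  have D: "Delta_density y = (\<lambda>v. ?s v - ?f v - (?r \<star> ?f) v)"
    by (rule ext) (rule Delta_density_def)
  have key: "((\<lambda>t. (?w t + ?r t) + (?w \<star> ?r) t) \<star> ?f) u = 0"
    unfolding buchstab_conv_dickman_deriv by (simp add: conv_def)
  have "((\<lambda>t. (?w t + ?r t) + (?w \<star> ?r) t) \<star> ?f) u = (?w \<star> ?f) u + (?r \<star> ?f) u + (?w \<star> ?r \<star> ?f) u"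
    using c by (simp add: conv_add_left causal_add causal_conv)
  moreover have "(Delta_density y \<star> ?w) u = (?s \<star> ?w) u - (?f \<star> ?w) u - (?r \<star> ?f \<star> ?w) u"
    unfolding D using c by (simp add: conv_diff_left causal_diff causal_conv)
  moreover have "?r \<star> ?f \<star> ?w = ?w \<star> ?r \<star> ?f"
    using c by (metis conv_assoc conv_commute)
  ultimately show ?thesis
    using key unfolding R_star_density_eq[OF assms] Delta_density_def conv_commute[of ?s ?w] conv_commute[of ?f ?w]
    by simp
qed

section \<open>Integrals of the rescaled error terms\<close>

text \<open>
  Integrate termwise: the step of a smooth \<open>n\<close> contributes the integral of \<open>y\<^sup>-\<^sup>v\<close> over
  \<open>v \<ge> log n / log y\<close>, that is \<open>1 / (n log y)\<close>.
\<close>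
lemma integral_smooth_density:
  assumes y: "y > 1"
  shows "integrable lborel (smooth_density y)"
    and "(LINT v|lborel. smooth_density y v) = (\<Sum>\<^sub>\<infinity>n\<in>smooth y. 1 / real n) / ln y"
proof -
  define f where "f n v = of_bool (n \<in> smooth y) *
    (indicator {ln (real n) / ln y..} v * exp (- ln y * v))" for n :: nat and v :: real
  have L: "ln y > 0" using y by simp
  have summand: "has_bochner_integral lborel (f n) (of_bool (n \<in> smooth y) * (1 / real n) / ln y)" for n
  proof (cases "n \<in> smooth y")
    case True
    then have "real n > 0" by (simp add: smooth_def)
    then have "exp (- ln y * (ln (real n) / ln y)) = 1 / real n"
      using L by (simp add: exp_minus inverse_eq_divide)
    then show ?thesis
      using has_bochner_integral_exp_tail[OF L, of "ln (real n) / ln y"] True unfolding f_def by simp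
  next
    case False
    then have "f n = (\<lambda>_. 0)" by (simp add: f_def fun_eq_iff)
    then show ?thesis using False by (simp add: has_bochner_integral_zero)
  qed
  have nonneg: "f n v \<ge> 0" for n v by (simp add: f_def)
  have f_sums: "(\<lambda>n. f n v) sums smooth_density y v" for v
  proof -
    let ?A = "{n \<in> smooth y. real n \<le> y powr v}"
    have f_eq: "f n v = (if n \<in> ?A then 1 / y powr v else 0)" for n
    proof (cases "n \<in> smooth y")
      case True
      then have n0: "real n > 0" by (simp add: smooth_def)
      have "ln (real n) / ln y \<le> v \<longleftrightarrow> real n \<le> y powr v"
        using log_le_iff[OF y n0, of v] by (simp add: log_def)
      then show ?thesis using True y
        by (simp add: f_def indicator_def powr_def exp_minus inverse_eq_divide mult.commute)
    qed (simp add: f_def)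
    have "(\<lambda>n. f n v) sums (\<Sum>n\<in>?A. f n v)"
      by (rule sums_finite) (use finite_nat_le_real f_eq in auto)
    also have "(\<Sum>n\<in>?A. f n v) = smooth_density y v"
      by (simp add: f_eq smooth_density_def Psi_def)
    finally show ?thesis .
  qed
  have "((\<lambda>n. 1 / real n) has_sum (\<Sum>\<^sub>\<infinity>n\<in>smooth y. 1 / real n)) (smooth y)"
    by (intro has_sum_infsum summable_on_inverse_smooth)
  then have "((\<lambda>n. of_bool (n \<in> smooth y) * (1 / real n)) has_sum (\<Sum>\<^sub>\<infinity>n\<in>smooth y. 1 / real n)) UNIV"
    by (rule has_sum_cong_neutral[THEN iffD1, rotated -1]) auto
  then have S: "(\<lambda>n. of_bool (n \<in> smooth y) * (1 / real n) / ln y) sums ((\<Sum>\<^sub>\<infinity>n\<in>smooth y. 1 / real n) / ln y)"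
    by (intro sums_divide has_sum_imp_sums)
  have i: "integrable lborel (f n)" for n using summand by (simp add: has_bochner_integral_iff)
  have a: "AE v in lborel. summable (\<lambda>n. norm (f n v))"
    using f_sums nonneg by (simp add: sums_iff)
  have b: "summable (\<lambda>n. LINT v|lborel. norm (f n v))"
    using summand nonneg S by (simp add: has_bochner_integral_iff sums_iff)
  have e: "(\<lambda>v. \<Sum>n. f n v) = smooth_density y" using f_sums by (simp add: sums_iff fun_eq_iff)
  show "integrable lborel (smooth_density y)"
    using integrable_suminf[OF i a b] unfolding e .
  have "(LINT v|lborel. smooth_density y v) = (\<Sum>n. LINT v|lborel. f n v)"
    using integral_suminf[OF i a b] unfolding e .
  also have "\<dots> = (\<Sum>\<^sub>\<infinity>n\<in>smooth y. 1 / real n) / ln y"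
    using summand S by (simp add: has_bochner_integral_iff sums_iff)
  finally show "(LINT v|lborel. smooth_density y v) = (\<Sum>\<^sub>\<infinity>n\<in>smooth y. 1 / real n) / ln y" .
qed

text \<open>
  With \<open>g\<close> the rescaled fractional part, the density of \<open>\<Delta>\<close> is \<open>\<psi> - \<rho> + g + \<rho>' \<star> g\<close>, and
  \<open>\<integral> \<rho>' = - 1\<close> makes the two terms with \<open>g\<close> cancel. The densities \<open>\<psi>\<close> and \<open>\<phi>\<close> tend to \<open>0\<close> and \<open>1\<close>,
  so \<open>\<phi>\<close> has to be replaced by \<open>g\<close> before integrating.
\<close>

lemma integral_Delta_density:
  assumes y: "y \<ge> 2"
  shows "integrable lborel (Delta_density y)"
    and "integral\<^sup>L lborel (Delta_density y) =
      (\<Sum>\<^sub>\<infinity>n\<in>smooth y. 1 / real n) / ln y - exp euler_mascheroni"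
proof -
  define g where "g v = heaviside v - floor_density y v" for v
  have cf: "causal (floor_density y)" using y by (intro causal_floor_density) auto
  have cg: "causal g" unfolding g_def using cf by auto
  have L: "ln y > 0" using y by simp
  have ig: "integrable lborel g"
  proof (rule integrable_exp_decay[where c = 0 and a = "ln y" and B = 1])
    fix t :: real assume "t \<ge> 0"
    then have "g t = frac (y powr t) / y powr t"
      using y by (simp add: g_def floor_density_def heaviside_def frac_def diff_divide_distrib)
    moreover have "\<bar>frac (y powr t) / y powr t\<bar> \<le> 1 / y powr t"
      using frac_lt_1[of "y powr t"] by (simp add: divide_right_mono)
    ultimately show "\<bar>g t\<bar> \<le> 1 * exp (- ln y * t)"
      using y by (simp add: powr_def exp_minus inverse_eq_divide mult.commute)
  qed (use L cg causal_neg causal_measurable in auto)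
  have D: "Delta_density y v = smooth_density y v - dickman v + g v + (dickman_deriv \<star> g) v" for v
  proof -
    have "(dickman_deriv \<star> g) v = (dickman_deriv \<star> heaviside) v - (dickman_deriv \<star> floor_density y) v"
      unfolding g_def by (intro conv_diff_right cf causal_heaviside causal_dickman_deriv)
    then show ?thesis
      by (simp add: Delta_density_def g_def dickman_eq_heaviside_conv conv_commute[of heaviside])
  qed
  note i = integral_smooth_density(1)[of y] integrable_dickman ig
    integral_conv(2)[OF integrable_dickman_deriv ig]
  have y1: "y > 1" using y by simp
  have DD: "Delta_density y = (\<lambda>v. smooth_density y v - dickman v + g v + (dickman_deriv \<star> g) v)"
    using D by (rule ext)
  show "integrable lborel (Delta_density y)"
    unfolding DD by (intro Bochner_Integration.integrable_add Bochner_Integration.integrable_diff i y1)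
  have "integral\<^sup>L lborel (Delta_density y) = integral\<^sup>L lborel (smooth_density y) - integral\<^sup>L lborel dickman
      + integral\<^sup>L lborel g + integral\<^sup>L lborel (dickman_deriv \<star> g)"
    unfolding DD
    by (simp only: Bochner_Integration.integral_add Bochner_Integration.integral_diff
        Bochner_Integration.integrable_add Bochner_Integration.integrable_diff i y1)
  also have "\<dots> = (\<Sum>\<^sub>\<infinity>n\<in>smooth y. 1 / real n) / ln y - exp euler_mascheroni"
    using integral_conv(1)[OF integrable_dickman_deriv ig] integral_smooth_density(2)[OF y1]
    by (simp add: integral_dickman integral_dickman_deriv)
  finally show "integral\<^sup>L lborel (Delta_density y) =
      (\<Sum>\<^sub>\<infinity>n\<in>smooth y. 1 / real n) / ln y - exp euler_mascheroni" .
qed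

text \<open>
  \<open>Q\<close> and \<open>Q\<^sup>*\<close> differ by a multiple of \<open>x\<close>, which is summed over smooth \<open>n\<close> with weights \<open>1 / n\<close>; the
  Euler product turns the term with \<open>\<Pi>(y)\<close> into \<open>1\<close>.
\<close>

lemma R_eq_R_star:
  assumes y: "y \<ge> 2" and x: "x > 0"
  shows "R x y = R_star x y
    + x * (1 - exp (- euler_mascheroni) * ((\<Sum>\<^sub>\<infinity>n\<in>smooth y. 1 / real n) / ln y))"
proof -
  define c where "c = Pi_prod y - exp (- euler_mascheroni) / ln y"
  have "R x y = (\<Sum>\<^sub>\<infinity>n\<in>smooth y. Q_star (x / real n) y + c * x * (1 / real n))"
    unfolding R_def
    by (rule infsum_cong) (simp add: Q_def Q_star_def V_def V_star_def Let_def c_def algebra_simps)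
  also have "\<dots> = R_star x y + (\<Sum>\<^sub>\<infinity>n\<in>smooth y. c * x * (1 / real n))"
    unfolding R_star_def
    by (intro infsum_add summable_on_R_star x y summable_on_cmult_right summable_on_inverse_smooth)
  also have "(\<Sum>\<^sub>\<infinity>n\<in>smooth y. c * x * (1 / real n)) = c * x * (\<Sum>\<^sub>\<infinity>n\<in>smooth y. 1 / real n)"
    by (rule infsum_cmult_right')
  also have "\<dots> = x * ((\<Sum>\<^sub>\<infinity>n\<in>smooth y. 1 / real n) * Pi_prod y
      - exp (- euler_mascheroni) * ((\<Sum>\<^sub>\<infinity>n\<in>smooth y. 1 / real n) / ln y))"
    by (simp add: c_def algebra_simps)
  finally show ?thesis by (simp add: infsum_inverse_smooth)
qed

section \<open>The four identities\<close>

theorem theorem1: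
  fixes x y u :: real
  assumes "x \<ge> 1" and "y \<ge> 2" and "u = ln x / ln y"
  shows
    "(set_integrable lborel {..u} (\<lambda>v. R (y powr v) y / y powr v * dickman_deriv (u - v)) \<and>
      Delta x y = R x y
        + x * (LBINT v:{..u}. R (y powr v) y / y powr v * dickman_deriv (u - v)))
     \<and>
     (set_integrable lborel {0..u}
        (\<lambda>v. R_star (y powr v) y / y powr v * dickman_deriv (u - v)) \<and>
      Delta x y = R_star x y
        + x * (LBINT v:{0..u}. R_star (y powr v) y / y powr v * dickman_deriv (u - v)))
     \<and>
     (set_integrable lborel {0..}
        (\<lambda>v. Delta (y powr v) y / y powr v * (buchstab (u - v) - exp (- euler_mascheroni))) \<and>
      R x y = Delta x y
        + x * (LBINT v:{0..}.
            Delta (y powr v) y / y powr v * (buchstab (u - v) - exp (- euler_mascheroni))))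
     \<and>
     (set_integrable lborel {0..u} (\<lambda>v. Delta (y powr v) y / y powr v * buchstab (u - v)) \<and>
      R_star x y = Delta x y
        + x * (LBINT v:{0..u}. Delta (y powr v) y / y powr v * buchstab (u - v)))"
proof -
  define \<sigma> where "\<sigma> = (\<Sum>\<^sub>\<infinity>n\<in>smooth y. 1 / real n) / ln y"
  define E :: real where "E = exp (- euler_mascheroni)"
  let ?r = "R_star_density y" and ?d = "Delta_density y"
  have E: "E * exp euler_mascheroni = 1" by (simp add: E_def flip: exp_add)
  note y = assms(2)
  have u: "u \<ge> 0" using assms by simp
  have xu: "y powr u = x" using assms powr_log_cancel_ln[of y x] by simp
  have x: "x > 0" using assms by simp
  note c = causal_R_star_density[OF y] causal_Delta_density[OF y] causal_dickman_deriv causal_buchstab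
  have r: "R_star x y = x * ?r u" using x by (simp add: R_star_density_def xu)
  have d: "Delta x y = x * ?d u" using Delta_density_eq[OF y u] x by (simp add: xu field_simps)
  have R: "R x y = x * (?r u + (1 - E * \<sigma>))"
    using R_eq_R_star[OF y x] by (simp add: r E_def \<sigma>_def algebra_simps)
  have Rv: "R (y powr v) y / y powr v = ?r v + (1 - E * \<sigma>)" for v
    using R_eq_R_star[OF y, of "y powr v"] y
    by (simp add: R_star_density_def E_def \<sigma>_def add_divide_distrib)
  have D1: "?d u = ?r u + (?r \<star> dickman_deriv) u" by (rule Delta_density_eq_R_star_density[OF y])
  have D2: "?r u = ?d u + (?d \<star> buchstab) u" by (rule R_star_density_eq_Delta_density[OF y])

  \<comment> \<open>As \<open>\<rho>'\<close> is supported on \<open>[1, \<infinity>)\<close>, cutting off at \<open>u\<close> is automatic.\<close>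
  have f1: "indicator {..u} v *\<^sub>R (R (y powr v) y / y powr v * dickman_deriv (u - v)) =
      ?r v * dickman_deriv (u - v) + (1 - E * \<sigma>) * dickman_deriv (u - v)" for v
    unfolding Rv by (cases "v \<le> u") (auto simp: dickman_deriv_below algebra_simps)
  have shift: "integrable lborel (\<lambda>v. dickman_deriv (u - v))"
    "(LINT v|lborel. dickman_deriv (u - v)) = - 1"
  proof -
    show "integrable lborel (\<lambda>v. dickman_deriv (u - v))"
      using lborel_integrable_real_affine[OF integrable_dickman_deriv, of "- 1" u] by simp
    show "(LINT v|lborel. dickman_deriv (u - v)) = - 1"
      using lborel_integral_real_affine[of "- 1" dickman_deriv u] by (simp add: integral_dickman_deriv)
  qed
  have i1: "integrable lborel (\<lambda>v. ?r v * dickman_deriv (u - v))" by (rule integrable_conv[OF c(1,3)])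
  have P1: "set_integrable lborel {..u} (\<lambda>v. R (y powr v) y / y powr v * dickman_deriv (u - v))"
    unfolding set_integrable_def f1
    by (intro Bochner_Integration.integrable_add integrable_mult_right i1 shift)
  have L1: "(LBINT v:{..u}. R (y powr v) y / y powr v * dickman_deriv (u - v)) =
      (?r \<star> dickman_deriv) u + (1 - E * \<sigma>) * - 1"
    unfolding set_lebesgue_integral_def f1 conv_def using i1 shift by simp
  have I1: "Delta x y = R x y + x * (LBINT v:{..u}. R (y powr v) y / y powr v * dickman_deriv (u - v))"
    unfolding d R D1 L1 by (simp add: algebra_simps)

  have P2: "set_integrable lborel {0..u} (\<lambda>v. R_star (y powr v) y / y powr v * dickman_deriv (u - v))"
    using set_integral_conv(2)[OF c(1,3)] by (simp add: R_star_density_def)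
  have "(LBINT v:{0..u}. R_star (y powr v) y / y powr v * dickman_deriv (u - v)) = (?r \<star> dickman_deriv) u"
    using set_integral_conv(1)[OF c(1,3)] by (simp add: R_star_density_def)
  then have I2: "Delta x y = R_star x y
      + x * (LBINT v:{0..u}. R_star (y powr v) y / y powr v * dickman_deriv (u - v))"
    unfolding d r D1 by (simp add: algebra_simps)

  \<comment> \<open>Likewise the support of \<open>\<omega>\<close> turns the integral over the half-line into a convolution,
    up to a multiple of the total integral of the rescaled \<open>\<Delta>\<close>.\<close>
  have f3: "indicator {0..} v *\<^sub>R (Delta (y powr v) y / y powr v * (buchstab (u - v) - exp (- euler_mascheroni))) =
      ?d v * buchstab (u - v) - E * ?d v" for v
    using Delta_density_eq[OF y, of v] causal_neg[OF c(2), of v]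
    by (cases "v < 0") (auto simp: E_def algebra_simps)
  have i3: "integrable lborel (\<lambda>v. ?d v * buchstab (u - v))" by (rule integrable_conv[OF c(2,4)])
  have P3: "set_integrable lborel {0..}
      (\<lambda>v. Delta (y powr v) y / y powr v * (buchstab (u - v) - exp (- euler_mascheroni)))"
    unfolding set_integrable_def f3
    by (intro Bochner_Integration.integrable_diff integrable_mult_right i3 integral_Delta_density y)
  have "(LBINT v:{0..}. Delta (y powr v) y / y powr v * (buchstab (u - v) - exp (- euler_mascheroni))) =
      (?d \<star> buchstab) u - E * (\<sigma> - exp euler_mascheroni)"
    unfolding set_lebesgue_integral_def f3 conv_def
    using i3 integral_Delta_density[OF y] by (simp add: \<sigma>_def)
  also have "\<dots> = (?d \<star> buchstab) u + (1 - E * \<sigma>)" using E by (simp add: algebra_simps)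
  finally have L3: "(LBINT v:{0..}. Delta (y powr v) y / y powr v * (buchstab (u - v) - exp (- euler_mascheroni))) =
      (?d \<star> buchstab) u + (1 - E * \<sigma>)" .
  have I3: "R x y = Delta x y + x * (LBINT v:{0..}.
      Delta (y powr v) y / y powr v * (buchstab (u - v) - exp (- euler_mascheroni)))"
    unfolding d R D2 L3 by (simp add: algebra_simps)

  have f4: "indicator {0..u} v *\<^sub>R (Delta (y powr v) y / y powr v * buchstab (u - v)) =
      indicator {0..u} v *\<^sub>R (?d v * buchstab (u - v))" for v
  proof (cases "v \<ge> 0")
    case True
    show ?thesis unfolding Delta_density_eq[OF y True] ..
  qed simp
  have P4: "set_integrable lborel {0..u} (\<lambda>v. Delta (y powr v) y / y powr v * buchstab (u - v))"
    using set_integral_conv(2)[OF c(2,4)] unfolding set_integrable_def f4 .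
  have "(LBINT v:{0..u}. Delta (y powr v) y / y powr v * buchstab (u - v)) = (?d \<star> buchstab) u"
    using set_integral_conv(1)[OF c(2,4)] unfolding set_lebesgue_integral_def f4 .
  then have I4: "R_star x y = Delta x y
      + x * (LBINT v:{0..u}. Delta (y powr v) y / y powr v * buchstab (u - v))"
    unfolding d r D2 by (simp add: algebra_simps)
  show ?thesis using P1 I1 P2 I2 P3 I3 P4 I4 by blast
qed

end
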